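(* Let $\mathcal{P}=\langle a_1,\ldots,a_n\mid r_1,\ldots,r_k\rangle$ be a presentation of a group $G$, with cyclically reduced relators and such that $H_1(G)$ is a nontrivial free abelian group of rank $n-k$. Let $\varphi:G\to\mathbb{Z}$ be a surjective homomorphism. If $\{r_1,\ldots,r_k\}$ is weakly concatenable with respect to $\varphi$, then the standard $2$-complex $\mathcal{K}_{\mathcal{P}}$ is weakly $\mathbb{Z}$-slim.
   Context: Presentations are finite. The standard $2$-complex $\mathcal{K}_{\mathcal{P}}$ has one $0$-cell, one $1$-cell for each generator and one $2$-cell for each relator, attached along the relator. Weak concatenability: by replacing, if necessary, generators by their inverses, one assumes $\varphi(a)\ge 0$ for every generator $a$. For a word $w$ in the generators, $\varphi(w)$ is its weight. For a relator $r$, consider the sequence of weights of the initial subwords of $r$ (e.g. for $r=a^{-1}b$ with $\varphi(a)=\varphi(b)=1$ it is $-1,0$), and let $m$ be its minimum. The multiset of minima $m_\varphi(r)$ contains one copy of the generator $a$ (a negative copy) for every initial subword of $r$ of the form $wa^{-1}$ with weight $m$, and one copy of $a$ (a positive copy) for every initial subword of $r$ of the form $wa$ with weight $m+\varphi(a)$. The family $\{r_1,\ldots,r_k\}$ is weakly concatenable with respect to $\varphi$ if there is an ordering $m_\varphi(r_{i_1}),\ldots,m_\varphi(r_{i_k})$ of the multisets of minima such that for every $1\le j\le k$ there is an element $x\in m_\varphi(r_{i_j})$ with $x\notin\bigcup_{s=1}^{j-1}m_\varphi(r_{i_s})$ and such that the numbers of positive and negative copies of $x$ in $m_\varphi(r_{i_j})$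 are different. All $2$-complexes and maps are combinatorial (open $n$-cells are sent homeomorphically onto open $n$-cells). For a group $H$, an $H$-covering is a (connected) regular covering with deck transformation group isomorphic to $H$. For a $2$-cell $R$, $\partial R$ is the $1$-complex formed by the edges traversed by its attaching path, with edge set $E(\partial R)$. For a preorder $\le$, write $a<b$ if $a\le b$ and not $b\le a$; "$E(\partial R)$ has a unique strictly minimal $1$-cell $\min(R)$" means $\min(R)\in E(\partial R)$ and $\min(R)<e$ for every other $e\in E(\partial R)$. A pair $(X,Y)$ of $2$-complexes is an elementary reduction if $X$ is obtained from $Y$ by attaching a $1$-cell $e$ and at most one $2$-cell $R$, where (if $R$ is present) the attaching path of $R$ is not homotopic in $Y\cup\{e\}$, as a closed path, to a path in $Y$. It is an $e$-elementary reduction if only $e$ is attached, and an $(R,e)$-elementary reduction if $R$ is also attached; the latter is simple if the attaching map of $R$ is not a proper power in $\pi_1(Y\cup\{e\})$; $e$-elementary reductions count as simple. A subcomplex $Y\subseteq X$ is a simple reduction of $X$ if it can be obtained from $X$ by countably many simple elementary reductions, i.e. there is a finite (possibly trivial) or countably infinite ascending chain $Y=X_0\subseteq X_1\subseteq\cdots$ of subcomplexes with union $X$ and each $(X_{i+1},X_i)$ a simple elementary reduction. (Isolated $0$-cells are disregarded in reductions: all complexes in a chain may be taken to contain all $0$-cells.) A $2$-complex $X$ is weakly $H$-slim if there is an $H$-covering $Z\to X$ such that: (1) there is an $H$-invariant preorder on the set $E(Z)$ of edges of $Z$; (2) for each $2$-cell $R$ of $Z$, $E(\partial R)$ has a unique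 strictly minimal $1$-cell $\min(R)$, and there is a simple $(R,\min(R))$-elementary reduction $(W,T)$ where $W\subseteq Z$ is a simple reduction of $Z$; (3) if $R_1\neq R_2$ are $2$-cells of $Z$ and $\min(R_1)$ appears in $\partial R_2$, then $\min(R_1)>\min(R_2)$. *)

theory Defs
  imports
    "HOL-Algebra.Generated_Groups"
    "HOL-Algebra.Free_Abelian_Groups"
    "HOL-Algebra.Bij"
    "HOL-Combinatorics.Permutations"
    "HOL-Library.Multiset"
    "HOL-Library.Extended_Nat"
begin

section \<open>Words and edge paths\<close>

text \<open>A letter \<open>(a, True)\<close> is the generator (or the edge, traversed along its orientation) \<open>a\<close>,
  and \<open>(a, False)\<close> is its formal inverse.\<close>

type_synonym 'a word = "('a \<times> bool) list"

definition inv_letter :: "'a \<times> bool \<Rightarrow> 'a \<times> bool"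
  where "inv_letter x = (fst x, \<not> snd x)"

definition inv_word :: "'a word \<Rightarrow> 'a word"
  where "inv_word w = rev (map inv_letter w)"

definition reduced :: "'a word \<Rightarrow> bool"
  where "reduced w \<longleftrightarrow> (\<forall>i. Suc i < length w \<longrightarrow> w ! Suc i \<noteq> inv_letter (w ! i))"

definition cyclically_reduced :: "'a word \<Rightarrow> bool"
  where "cyclically_reduced w \<longleftrightarrow> reduced w \<and> (w \<noteq> [] \<longrightarrow> hd w \<noteq> inv_letter (last w))"


section \<open>Group presentations\<close>

text \<open>A finite presentation is given by the number \<open>n\<close> of generators, which are named
  \<open>0, \<dots>, n - 1\<close>, and the list \<open>rs\<close> of its relators.\<close>

definition words :: "nat \<Rightarrow> nat word set"
  where "words n = {w. fst ` set w \<subseteq> {..<n}}"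

definition presentation :: "nat \<Rightarrow> nat word list \<Rightarrow> bool"
  where "presentation n rs \<longleftrightarrow> set rs \<subseteq> words n"

inductive insertion :: "nat \<Rightarrow> nat word list \<Rightarrow> nat word \<Rightarrow> nat word \<Rightarrow> bool"
  for n :: nat and rs :: "nat word list"
  where
    cancelling_pair:
      "u \<in> words n \<Longrightarrow> v \<in> words n \<Longrightarrow> fst x < n \<Longrightarrow> insertion n rs (u @ v) (u @ [x, inv_letter x] @ v)"
  | relator:
      "u \<in> words n \<Longrightarrow> v \<in> words n \<Longrightarrow> r \<in> set rs \<Longrightarrow> insertion n rs (u @ v) (u @ r @ v)"

text \<open>Inserting an inverse relator is a composition: insert \<open>r\<inverse>r\<close> by cancelling pairs and
  then delete \<open>r\<close>.\<close>

definition word_class :: "nat \<Rightarrow> nat word list \<Rightarrow> nat word \<Rightarrow> nat word set"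
  where "word_class n rs w = {w'. equivclp (insertion n rs) w w'}"

definition presented_group :: "nat \<Rightarrow> nat word list \<Rightarrow> nat word set monoid"
  where "presented_group n rs =
    \<lparr>carrier = word_class n rs ` words n,
     monoid.mult = (\<lambda>A B. \<Union>u\<in>A. \<Union>v\<in>B. word_class n rs (u @ v)),
     one = word_class n rs []\<rparr>"

text \<open>The first homology group of a group is its abelianization.\<close>

definition H1 :: "('a, 'm) monoid_scheme \<Rightarrow> 'a set monoid"
  where "H1 G = G Mod (derived G (carrier G))"


section \<open>Weak concatenability\<close>

text \<open>The function \<open>c\<close> assigns to each generator its weight.\<close>

definition weight :: "('a \<Rightarrow> int) \<Rightarrow> 'a word \<Rightarrow> int"
  where "weight c w = (\<Sum>(a, s)\<leftarrow>w. if s then c a else - c a)"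

definition min_weight :: "('a \<Rightarrow> int) \<Rightarrow> 'a word \<Rightarrow> int"
  where "min_weight c r = Min ((\<lambda>i. weight c (take i r)) ` {1..length r})"

text \<open>The multiset of minima: \<open>(a, True)\<close> stands for a positive copy of \<open>a\<close> and \<open>(a, False)\<close> for a
  negative one. The initial subword that ends with the letter \<open>r ! i\<close> is \<open>take (Suc i) r\<close>.\<close>

definition minima :: "('a \<Rightarrow> int) \<Rightarrow> 'a word \<Rightarrow> ('a \<times> bool) multiset"
  where "minima c r = mset (map (\<lambda>i. r ! i) (filter
    (\<lambda>i. weight c (take (Suc i) r) =
          min_weight c r + (if snd (r ! i) then c (fst (r ! i)) else 0))
    [0..<length r]))"

text \<open>Replacing each generator of negative weight by its inverse turns the weights \<open>c\<close> into \<open>\<bar>c\<bar>\<close> and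
  rewrites the relators as follows.\<close>

definition reorient :: "('a \<Rightarrow> int) \<Rightarrow> 'a word \<Rightarrow> 'a word"
  where "reorient c w = map (\<lambda>(a, s). (a, if c a < 0 then \<not> s else s)) w"

definition weakly_concatenable :: "('a \<Rightarrow> int) \<Rightarrow> 'a word list \<Rightarrow> bool"
  where "weakly_concatenable c rs \<longleftrightarrow>
    (let k = length rs; M = (\<lambda>i. minima (\<lambda>a. \<bar>c a\<bar>) (reorient c (rs ! i))) in
     \<exists>\<sigma>. \<sigma> permutes {..<k} \<and>
       (\<forall>j<k. \<exists>x. x \<in> fst ` set_mset (M (\<sigma> j)) \<and>
          x \<notin> (\<Union>s<j. fst ` set_mset (M (\<sigma> s))) \<and>
          count (M (\<sigma> j)) (x, True) \<noteq> count (M (\<sigma> j)) (x, False)))"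


section \<open>Combinatorial 2-complexes\<close>

text \<open>Each edge carries a reference orientation from \<open>src\<close> to \<open>tgt\<close>. The attaching path of a
  2-cell \<open>R\<close> is the closed edge path \<open>att R\<close> based at \<open>base R\<close>.\<close>

record ('v, 'e, 'f) complex2 =
  verts :: "'v set"
  edges :: "'e set"
  faces :: "'f set"
  src :: "'e \<Rightarrow> 'v"
  tgt :: "'e \<Rightarrow> 'v"
  base :: "'f \<Rightarrow> 'v"
  att :: "'f \<Rightarrow> 'e word"

definition step_start :: "('v, 'e, 'f) complex2 \<Rightarrow> 'e \<times> bool \<Rightarrow> 'v"
  where "step_start X x = (if snd x then src X (fst x) else tgt X (fst x))"

definition step_end :: "('v, 'e, 'f) complex2 \<Rightarrow> 'e \<times> bool \<Rightarrow> 'v"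
  where "step_end X x = (if snd x then tgt X (fst x) else src X (fst x))"

fun is_path :: "('v, 'e, 'f) complex2 \<Rightarrow> 'v \<Rightarrow> 'e word \<Rightarrow> 'v \<Rightarrow> bool"
  where
    "is_path X u [] v \<longleftrightarrow> u \<in> verts X \<and> u = v"
  | "is_path X u (x # p) v \<longleftrightarrow>
       u \<in> verts X \<and> fst x \<in> edges X \<and> step_start X x = u \<and> is_path X (step_end X x) p v"

definition two_complex :: "('v, 'e, 'f) complex2 \<Rightarrow> bool"
  where "two_complex X \<longleftrightarrow>
    (\<forall>e\<in>edges X. src X e \<in> verts X \<and> tgt X e \<in> verts X) \<and>
    (\<forall>R\<in>faces X. is_path X (base X R) (att X R) (base X R))"

definition connected_complex :: "('v, 'e, 'f) complex2 \<Rightarrow> bool"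
  where "connected_complex X \<longleftrightarrow>
    verts X \<noteq> {} \<and> (\<forall>u\<in>verts X. \<forall>v\<in>verts X. \<exists>p. is_path X u p v)"

definition boundary_edges :: "('v, 'e, 'f) complex2 \<Rightarrow> 'f \<Rightarrow> 'e set"
  where "boundary_edges X R = fst ` set (att X R)"

definition standard_complex :: "nat \<Rightarrow> nat word list \<Rightarrow> (unit, nat, nat) complex2"
  where "standard_complex n rs =
    \<lparr>verts = {()}, edges = {..<n}, faces = {..<length rs},
     src = (\<lambda>_. ()), tgt = (\<lambda>_. ()), base = (\<lambda>_. ()), att = (\<lambda>i. rs ! i)\<rparr>"


subsection \<open>Homotopy of edge paths\<close>

inductive path_insertion :: "('v, 'e, 'f) complex2 \<Rightarrow> 'v \<Rightarrow> 'v \<Rightarrow> 'e word \<Rightarrow> 'e word \<Rightarrow> bool"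
  for X :: "('v, 'e, 'f) complex2" and u v :: 'v
  where
    backtrack:
      "is_path X u p w \<Longrightarrow> is_path X w q v \<Longrightarrow> fst x \<in> edges X \<Longrightarrow> step_start X x = w \<Longrightarrow>
       path_insertion X u v (p @ q) (p @ [x, inv_letter x] @ q)"
  | face:
      "is_path X u p w \<Longrightarrow> is_path X w q v \<Longrightarrow> R \<in> faces X \<Longrightarrow> base X R = w \<Longrightarrow>
       path_insertion X u v (p @ q) (p @ att X R @ q)"

definition homotopic_paths_rel :: "('v, 'e, 'f) complex2 \<Rightarrow> 'v \<Rightarrow> 'v \<Rightarrow> 'e word \<Rightarrow> 'e word \<Rightarrow> bool"
  where "homotopic_paths_rel X u v p q \<longleftrightarrow>
    is_path X u p v \<and> is_path X u q v \<and> equivclp (path_insertion X u v) p q"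

text \<open>Homotopy of closed paths, with moving base point: \<open>p\<close> is based at \<open>u\<close> and \<open>q\<close> at \<open>v\<close>, and \<open>c\<close> is
  the track of the base point.\<close>

definition homotopic_closed_paths :: "('v, 'e, 'f) complex2 \<Rightarrow> 'v \<Rightarrow> 'e word \<Rightarrow> 'v \<Rightarrow> 'e word \<Rightarrow> bool"
  where "homotopic_closed_paths X u p v q \<longleftrightarrow>
    is_path X u p u \<and> is_path X v q v \<and>
    (\<exists>c. is_path X u c v \<and> homotopic_paths_rel X u u p (c @ q @ inv_word c))"

definition path_class :: "('v, 'e, 'f) complex2 \<Rightarrow> 'v \<Rightarrow> 'e word \<Rightarrow> 'e word set"
  where "path_class X v p = {q. homotopic_paths_rel X v v p q}"

definition fundamental_group :: "('v, 'e, 'f) complex2 \<Rightarrow> 'v \<Rightarrow> 'e word set monoid"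
  where "fundamental_group X v =
    \<lparr>carrier = path_class X v ` {p. is_path X v p v},
     monoid.mult = (\<lambda>A B. \<Union>p\<in>A. \<Union>q\<in>B. path_class X v (p @ q)),
     one = path_class X v []\<rparr>"

definition proper_power :: "('a, 'm) monoid_scheme \<Rightarrow> 'a \<Rightarrow> bool"
  where "proper_power G g \<longleftrightarrow> (\<exists>h\<in>carrier G. \<exists>n::nat. n \<ge> 2 \<and> g = h [^]\<^bsub>G\<^esub> n)"


subsection \<open>Reductions\<close>

definition subcomplex :: "('v, 'e, 'f) complex2 \<Rightarrow> ('v, 'e, 'f) complex2 \<Rightarrow> bool"
  where "subcomplex Y X \<longleftrightarrow> two_complex Y \<and> two_complex X \<and>
    verts Y \<subseteq> verts X \<and> edges Y \<subseteq> edges X \<and> faces Y \<subseteq> faces X \<and>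
    src Y = src X \<and> tgt Y = tgt X \<and> base Y = base X \<and> att Y = att X"

definition add_edge :: "'e \<Rightarrow> ('v, 'e, 'f) complex2 \<Rightarrow> ('v, 'e, 'f) complex2"
  where "add_edge e Y = Y\<lparr>edges := insert e (edges Y)\<rparr>"

text \<open>Attaching cells of dimension 1 and 2 does not change the set of 0-cells.\<close>

definition e_elementary_reduction ::
    "'e \<Rightarrow> ('v, 'e, 'f) complex2 \<Rightarrow> ('v, 'e, 'f) complex2 \<Rightarrow> bool"
  where "e_elementary_reduction e X Y \<longleftrightarrow> subcomplex Y X \<and> verts X = verts Y \<and>
    e \<notin> edges Y \<and> edges X = insert e (edges Y) \<and> faces X = faces Y"

definition Re_elementary_reduction ::
    "'f \<Rightarrow> 'e \<Rightarrow> ('v, 'e, 'f) complex2 \<Rightarrow> ('v, 'e, 'f) complex2 \<Rightarrow> bool"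
  where "Re_elementary_reduction R e X Y \<longleftrightarrow> subcomplex Y X \<and> verts X = verts Y \<and>
    e \<notin> edges Y \<and> edges X = insert e (edges Y) \<and>
    R \<notin> faces Y \<and> faces X = insert R (faces Y) \<and>
    \<not> (\<exists>v q. is_path Y v q v \<and>
         homotopic_closed_paths (add_edge e Y) (base X R) (att X R) v q)"

definition simple_Re_elementary_reduction ::
    "'f \<Rightarrow> 'e \<Rightarrow> ('v, 'e, 'f) complex2 \<Rightarrow> ('v, 'e, 'f) complex2 \<Rightarrow> bool"
  where "simple_Re_elementary_reduction R e X Y \<longleftrightarrow> Re_elementary_reduction R e X Y \<and>
    \<not> proper_power (fundamental_group (add_edge e Y) (base X R))
        (path_class (add_edge e Y) (base X R) (att X R))"

definition simple_elementary_reduction ::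
    "('v, 'e, 'f) complex2 \<Rightarrow> ('v, 'e, 'f) complex2 \<Rightarrow> bool"
  where "simple_elementary_reduction X Y \<longleftrightarrow>
    (\<exists>e. e_elementary_reduction e X Y) \<or> (\<exists>R e. simple_Re_elementary_reduction R e X Y)"

text \<open>The chain \<open>C 0, C 1, \<dots>\<close> has \<open>N\<close> steps; \<open>N = \<infinity>\<close> is an infinite chain and \<open>N = 0\<close> the trivial
  one.\<close>

definition simple_reduction ::
    "('v, 'e, 'f) complex2 \<Rightarrow> ('v, 'e, 'f) complex2 \<Rightarrow> bool"
  where "simple_reduction X Y \<longleftrightarrow> two_complex X \<and>
    (\<exists>(N::enat) (C :: nat \<Rightarrow> ('v, 'e, 'f) complex2). C 0 = Y \<and>
       (\<forall>i. enat i \<le> N \<longrightarrow> subcomplex (C i) X) \<and>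
       (\<forall>i. enat i < N \<longrightarrow> simple_elementary_reduction (C (Suc i)) (C i)) \<and>
       verts X = (\<Union>i\<in>{i. enat i \<le> N}. verts (C i)) \<and>
       edges X = (\<Union>i\<in>{i. enat i \<le> N}. edges (C i)) \<and>
       faces X = (\<Union>i\<in>{i. enat i \<le> N}. faces (C i)))"


subsection \<open>Coverings\<close>

text \<open>A combinatorial map is required to respect the reference orientations, the base points and the
  attaching paths on the nose. For a covering \<open>Z \<rightarrow> X\<close> and its deck transformations this only means
  that the cells of \<open>Z\<close> carry the orientations and attaching paths lifted from \<open>X\<close>, which one can
  always choose. It matters for deck transformations: distinct 2-cells of \<open>Z\<close> over the same 2-cell of
  \<open>X\<close> can have the same boundary cycle (when an attaching path is a proper power), and they are told
  apart by their base points.\<close>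

record ('v, 'e, 'f, 'w, 'd, 'g) cell_map =
  vmap :: "'v \<Rightarrow> 'w"
  emap :: "'e \<Rightarrow> 'd"
  fmap :: "'f \<Rightarrow> 'g"

definition combinatorial_map ::
    "('v, 'e, 'f) complex2 \<Rightarrow> ('w, 'd, 'g) complex2 \<Rightarrow> ('v, 'e, 'f, 'w, 'd, 'g) cell_map \<Rightarrow> bool"
  where "combinatorial_map Z X p \<longleftrightarrow>
    (\<forall>z\<in>verts Z. vmap p z \<in> verts X) \<and>
    (\<forall>e\<in>edges Z. emap p e \<in> edges X \<and>
       src X (emap p e) = vmap p (src Z e) \<and> tgt X (emap p e) = vmap p (tgt Z e)) \<and>
    (\<forall>R\<in>faces Z. fmap p R \<in> faces X \<and> base X (fmap p R) = vmap p (base Z R) \<and>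
       att X (fmap p R) = map (\<lambda>(e, s). (emap p e, s)) (att Z R))"

text \<open>Local injectivity and surjectivity: every oriented edge of \<open>X\<close>, and every 2-cell of \<open>X\<close>, has
  exactly one lift at each point over its starting, respectively base, point.\<close>

definition covering ::
    "('v, 'e, 'f) complex2 \<Rightarrow> ('w, 'd, 'g) complex2 \<Rightarrow> ('v, 'e, 'f, 'w, 'd, 'g) cell_map \<Rightarrow> bool"
  where "covering Z X p \<longleftrightarrow> two_complex Z \<and> two_complex X \<and> combinatorial_map Z X p \<and>
    vmap p ` verts Z = verts X \<and>
    (\<forall>z\<in>verts Z. \<forall>d\<in>edges X.
       (src X d = vmap p z \<longrightarrow> (\<exists>!e. e \<in> edges Z \<and> src Z e = z \<and> emap p e = d)) \<and>
       (tgt X d = vmap p z \<longrightarrow> (\<exists>!e. e \<in> edges Z \<and> tgt Z e = z \<and> emap p e = d))) \<and>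
    (\<forall>z\<in>verts Z. \<forall>S\<in>faces X.
       base X S = vmap p z \<longrightarrow> (\<exists>!R. R \<in> faces Z \<and> base Z R = z \<and> fmap p R = S))"

definition deck_group ::
    "('v, 'e, 'f) complex2 \<Rightarrow> ('v, 'e, 'f, 'w, 'd, 'g) cell_map \<Rightarrow>
     ('v, 'e, 'f, 'v, 'e, 'f) cell_map monoid"
  where "deck_group Z p =
    \<lparr>carrier = {g. combinatorial_map Z Z g \<and>
       vmap g \<in> Bij (verts Z) \<and> emap g \<in> Bij (edges Z) \<and> fmap g \<in> Bij (faces Z) \<and>
       (\<forall>z\<in>verts Z. vmap p (vmap g z) = vmap p z) \<and>
       (\<forall>e\<in>edges Z. emap p (emap g e) = emap p e) \<and>
       (\<forall>R\<in>faces Z. fmap p (fmap g R) = fmap p R)},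
     monoid.mult = (\<lambda>g h. \<lparr>vmap = compose (verts Z) (vmap g) (vmap h),
       emap = compose (edges Z) (emap g) (emap h), fmap = compose (faces Z) (fmap g) (fmap h)\<rparr>),
     one = \<lparr>vmap = restrict id (verts Z), emap = restrict id (edges Z),
       fmap = restrict id (faces Z)\<rparr>\<rparr>"

definition H_covering ::
    "('h, 'm) monoid_scheme \<Rightarrow> ('v, 'e, 'f) complex2 \<Rightarrow> ('w, 'd, 'g) complex2 \<Rightarrow>
     ('v, 'e, 'f, 'w, 'd, 'g) cell_map \<Rightarrow> bool"
  where "H_covering H Z X p \<longleftrightarrow> covering Z X p \<and> connected_complex Z \<and>
    (\<forall>z\<in>verts Z. \<forall>z'\<in>verts Z. vmap p z = vmap p z' \<longrightarrow>
       (\<exists>g\<in>carrier (deck_group Z p). vmap g z = z')) \<and>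
    deck_group Z p \<cong> H"


section \<open>Weakly slim complexes\<close>

definition strictly_less :: "('a \<times> 'a) set \<Rightarrow> 'a \<Rightarrow> 'a \<Rightarrow> bool"
  where "strictly_less r a b \<longleftrightarrow> (a, b) \<in> r \<and> (b, a) \<notin> r"

definition is_min_edge ::
    "('e \<times> 'e) set \<Rightarrow> ('v, 'e, 'f) complex2 \<Rightarrow> 'f \<Rightarrow> 'e \<Rightarrow> bool"
  where "is_min_edge r Z R e \<longleftrightarrow> e \<in> boundary_edges Z R \<and>
    (\<forall>e'\<in>boundary_edges Z R - {e}. strictly_less r e e')"

definition min_edge :: "('e \<times> 'e) set \<Rightarrow> ('v, 'e, 'f) complex2 \<Rightarrow> 'f \<Rightarrow> 'e"
  where "min_edge r Z R = (THE e. is_min_edge r Z R e)"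

text \<open>In a connected regular covering with deck transformation group isomorphic to \<open>H\<close>, the cells
  over a given cell are in bijection with \<open>H\<close>. So, up to isomorphism, the cells of every
  \<open>H\<close>-covering of \<open>X\<close> are pairs of a cell of \<open>X\<close> and an element of \<open>H\<close>, and it is no restriction
  that the existential quantifier ranges over complexes \<open>Z\<close> of this type.\<close>

definition weakly_slim :: "('h, 'm) monoid_scheme \<Rightarrow> ('v, 'e, 'f) complex2 \<Rightarrow> bool"
  where "weakly_slim H X \<longleftrightarrow>
    (\<exists>(Z :: ('v \<times> 'h, 'e \<times> 'h, 'f \<times> 'h) complex2) p r.
       H_covering H Z X p \<and>
       preorder_on (edges Z) r \<and>
       (\<forall>g\<in>carrier (deck_group Z p). \<forall>e\<in>edges Z. \<forall>e'\<in>edges Z.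
          (e, e') \<in> r \<longleftrightarrow> (emap g e, emap g e') \<in> r) \<and>
       (\<forall>R\<in>faces Z. (\<exists>!e. is_min_edge r Z R e) \<and>
          (\<exists>W T. subcomplex W Z \<and> simple_reduction Z W \<and>
             simple_Re_elementary_reduction R (min_edge r Z R) W T)) \<and>
       (\<forall>R1\<in>faces Z. \<forall>R2\<in>faces Z.
          R1 \<noteq> R2 \<and> min_edge r Z R1 \<in> boundary_edges Z R2 \<longrightarrow>
          strictly_less r (min_edge r Z R2) (min_edge r Z R1)))"

end

theory Submission
  imports Defs "HOL-Computational_Algebra.Primes"
begin

text \<open>In the infinite cyclic covering given by \<open>\<phi>\<close>, the edges are ordered first by the level of their
  lowest end point and then by a ranking of the generators that reverses the order of weak
  concatenability, so that each 2-cell has a least edge. The order type of all edges is \<open>\<int>\<close>,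
  so the covering is exhausted by the subcomplexes spanned by upper sets, each of which arises from
  the previous one by adding one edge \<open>e\<close> and the 2-cell \<open>R\<close> with least edge \<open>e\<close>, if there is one.
  By weak concatenability \<open>e\<close> has nonzero exponent in \<open>\<partial>R\<close>, so this is an elementary
  reduction. If \<open>\<partial>R\<close> were a proper power, then for some prime \<open>p\<close> the cellular chain complex of the covering
  would have a 2-cycle modulo \<open>p\<close>. But as \<open>H\<^sub>1(G)\<close> is free abelian of rank \<open>n - k\<close>, the exponent matrix of the
  relators has rank \<open>k\<close> modulo \<open>p\<close>, hence the boundary map over \<open>F\<^sub>p[t, t\<^sup>-\<^sup>1]\<close>, which lifts it along
  \<open>t \<mapsto> 1\<close>, is injective.\<close>


section \<open>Words\<close>

lemma weight_Nil [simp]: "weight c [] = 0"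
  by (simp add: weight_def)

lemma weight_Cons [simp]:
  "weight c (x # w) = (if snd x then c (fst x) else - c (fst x)) + weight c w"
  by (simp add: weight_def case_prod_beta)

lemma weight_append [simp]: "weight c (u @ v) = weight c u + weight c v"
  by (induction u) auto

lemma fst_inv_letter [simp]: "fst (inv_letter x) = fst x"
  by (simp add: inv_letter_def)

lemma snd_inv_letter [simp]: "snd (inv_letter x) = (\<not> snd x)"
  by (simp add: inv_letter_def)

lemma inv_word_Nil [simp]: "inv_word [] = []"
  by (simp add: inv_word_def)

lemma inv_word_Cons [simp]: "inv_word (x # w) = inv_word w @ [inv_letter x]"
  by (simp add: inv_word_def)

lemma weight_inv_word [simp]: "weight c (inv_word w) = - weight c w"
  by (induction w) auto

lemma fst_set_inv_word [simp]: "fst ` set (inv_word w) = fst ` set w"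
  by (induction w) auto

lemma weight_concat_replicate: "weight c (concat (replicate m w)) = int m * weight c w"
  by (induction m) (auto simp: algebra_simps)

lemma weight_cong: "(\<And>a. a \<in> fst ` set w \<Longrightarrow> f a = g a) \<Longrightarrow> weight f w = weight g w"
  by (induction w) auto

lemma weight_eq_0: "(\<And>a. a \<in> fst ` set w \<Longrightarrow> f a = 0) \<Longrightarrow> weight f w = 0"
  by (induction w) auto

lemma weight_diff: "weight (\<lambda>a. f a - g a) w = weight f w - weight g w"
  by (induction w) auto

text \<open>The weight is linear in the cochain \<open>f\<close>, so the indicator cochains
  determine it. With 2-cells as letters, this turns a word into the coefficients of a
  2-chain.\<close>

lemma weight_eq_sum:
  assumes "finite A" "fst ` set w \<subseteq> A"
  shows "weight f w = (\<Sum>a\<in>A. weight (\<lambda>b. of_bool (b = a)) w * f a)"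
  using assms(2)
proof (induction w)
  case (Cons x w)
  have "(\<Sum>a\<in>A. weight (\<lambda>b. of_bool (b = a)) (x # w) * f a)
      = (\<Sum>a\<in>A. if a = fst x then (if snd x then f a else - f a) else 0)
        + (\<Sum>a\<in>A. weight (\<lambda>b. of_bool (b = a)) w * f a)"
    by (subst sum.distrib[symmetric], rule sum.cong) (auto simp: algebra_simps)
  then show ?case
    using Cons assms(1) by (auto simp: sum.delta)
qed simp


section \<open>The presented group\<close>

lemma words_Nil [simp]: "[] \<in> words n"
  by (simp add: words_def)

lemma words_Cons [simp]: "x # w \<in> words n \<longleftrightarrow> fst x < n \<and> w \<in> words n"
  by (auto simp: words_def)

lemma words_append [simp]: "u @ v \<in> words n \<longleftrightarrow> u \<in> words n \<and> v \<in> words n"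
  by (auto simp: words_def)

lemma inv_word_in_words [simp]: "inv_word w \<in> words n \<longleftrightarrow> w \<in> words n"
  by (simp add: words_def)

lemma insertion_append:
  assumes "insertion n rs w w'" "a \<in> words n" "b \<in> words n"
  shows "insertion n rs (a @ w @ b) (a @ w' @ b)"
  using assms(1)
proof cases
  case (cancelling_pair u v x)
  then show ?thesis
    using insertion.cancelling_pair[of "a @ u" n "v @ b" x rs] assms by simp
next
  case (relator u v r)
  then show ?thesis
    using insertion.relator[of "a @ u" n "v @ b" r rs] assms by simp
qed

lemma equivclp_map:
  assumes "equivclp r x y" "\<And>x y. r x y \<Longrightarrow> s (f x) (f y)"
  shows "equivclp s (f x) (f y)"
  using assms(1)
proof induction
  case (step y z)
  then have "equivclp s (f y) (f z)"
    using assms(2) equivclp_sym r_into_equivclp by metis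
  then show ?case
    using step.IH by (meson equivclp_trans)
qed simp

lemma equivclp_insertion_append:
  assumes "equivclp (insertion n rs) w w'" "a \<in> words n" "b \<in> words n"
  shows "equivclp (insertion n rs) (a @ w @ b) (a @ w' @ b)"
  using equivclp_map[OF assms(1), of "insertion n rs" "\<lambda>w. a @ w @ b"] insertion_append assms(2,3)
  by blast

lemma insertion_words:
  assumes "insertion n rs w w'" "presentation n rs"
  shows "w \<in> words n" "w' \<in> words n"
  using assms by (cases; auto simp: presentation_def)+

lemma equivclp_insertion_words:
  assumes "equivclp (insertion n rs) w w'" "presentation n rs" "w \<in> words n"
  shows "w' \<in> words n"
  using assms(1)
proof induction
  case (step y z)
  then show ?case using insertion_words[OF _ assms(2)] by blast
qed (rule assms(3))

lemma word_class_eq_iff: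
  "word_class n rs u = word_class n rs v \<longleftrightarrow> equivclp (insertion n rs) u v"
proof
  assume eq: "word_class n rs u = word_class n rs v"
  have "v \<in> word_class n rs u"
    unfolding eq by (simp add: word_class_def)
  then show "equivclp (insertion n rs) u v"
    by (simp add: word_class_def)
next
  assume e: "equivclp (insertion n rs) u v"
  have "equivclp (insertion n rs) u w \<longleftrightarrow> equivclp (insertion n rs) v w" for w
    using equivclp_trans[OF e, of w] equivclp_trans[OF equivclp_sym[OF e], of w] by blast
  then show "word_class n rs u = word_class n rs v"
    by (simp add: word_class_def)
qed

text \<open>The union in the product ranges over all representatives. It collapses to one class
  because insertion is a congruence for concatenation.\<close>

lemma mult_presented_group:
  assumes P: "presentation n rs" and u: "u \<in> words n" and v: "v \<in> words n"
  shows "word_class n rs u \<otimes>\<^bsub>presented_group n rs\<^esub> word_class n rs v = word_class n rs (u @ v)"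
proof -
  have "word_class n rs (u' @ v') = word_class n rs (u @ v)"
    if "u' \<in> word_class n rs u" "v' \<in> word_class n rs v" for u' v'
  proof -
    have uu: "equivclp (insertion n rs) u u'" and vv: "equivclp (insertion n rs) v v'"
      using that by (auto simp: word_class_def)
    have "v' \<in> words n"
      using equivclp_insertion_words[OF vv P v] .
    then have "equivclp (insertion n rs) (u @ v') (u' @ v')"
      using equivclp_insertion_append[OF uu, of "[]" v'] by simp
    moreover have "equivclp (insertion n rs) (u @ v) (u @ v')"
      using equivclp_insertion_append[OF vv u, of "[]"] by simp
    ultimately show ?thesis
      unfolding word_class_eq_iff by (meson equivclp_sym equivclp_trans)
  qed
  then have "(\<Union>u'\<in>word_class n rs u. \<Union>v'\<in>word_class n rs v. word_class n rs (u' @ v'))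
      = (\<Union>u'\<in>word_class n rs u. \<Union>v'\<in>word_class n rs v. word_class n rs (u @ v))"
    by (intro SUP_cong refl)
  moreover have "u \<in> word_class n rs u" "v \<in> word_class n rs v"
    by (auto simp: word_class_def)
  ultimately show ?thesis
    unfolding presented_group_def by (auto simp del: UN_simps)
qed

text \<open>A cancelling pair has weight 0 and a relator has weight divisible by \<open>p\<close>.
  So \<open>f\<close> induces a homomorphism from the presented group to the integers modulo
  \<open>p\<close>.\<close>

lemma weight_cong_insertion:
  assumes "equivclp (insertion n rs) w w'" "\<And>r. r \<in> set rs \<Longrightarrow> p dvd weight f r"
  shows "p dvd weight f w' - weight f w"
  using assms(1)
proof induction
  case (step y z)
  have ins: "p dvd weight f z - weight f y" if "insertion n rs y z" for y z
    using that by cases (auto simp: assms(2))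
  have "p dvd weight f z - weight f y"
    using step(2) ins dvd_diff_commute by metis
  then have "p dvd (weight f z - weight f y) + (weight f y - weight f w)"
    using step.IH by (rule dvd_add)
  then show ?case by simp
qed simp

lemma class_relator: "r \<in> set rs \<Longrightarrow> word_class n rs r = word_class n rs []"
  unfolding word_class_eq_iff
  using equivclp_sym[OF r_into_equivclp[of "insertion n rs", OF insertion.relator[of "[]" n "[]" r rs]]]
  by simp

lemma class_cancel:
  assumes "w \<in> words n"
  shows "word_class n rs (w @ inv_word w) = word_class n rs []"
  unfolding word_class_eq_iff using assms
proof (induction w)
  case (Cons x w)
  then have "equivclp (insertion n rs) ([x] @ (w @ inv_word w) @ [inv_letter x])
      ([x] @ [] @ [inv_letter x])"
    by (intro equivclp_insertion_append) auto
  moreover have "insertion n rs ([] @ []) ([] @ [x, inv_letter x] @ [])"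
    by (rule insertion.cancelling_pair) (use Cons in auto)
  then have "equivclp (insertion n rs) ([x] @ [] @ [inv_letter x]) []"
    by (simp add: equivclp_sym[OF r_into_equivclp])
  ultimately have "equivclp (insertion n rs) ([x] @ (w @ inv_word w) @ [inv_letter x]) []"
    by (rule equivclp_trans)
  then show ?case by simp
qed simp

locale presented =
  fixes n :: nat and rs :: "nat word list" and G :: "('g, 'm) monoid_scheme" (structure)
    and \<theta> :: "nat word set \<Rightarrow> 'g"
  assumes pres: "presentation n rs" and group_G: "group G"
    and iso: "\<theta> \<in> iso (presented_group n rs) G"
begin

sublocale group G by (rule group_G)

definition ev :: "nat word \<Rightarrow> 'g"
  where "ev w = \<theta> (word_class n rs w)"

lemma ev_closed [simp]: "w \<in> words n \<Longrightarrow> ev w \<in> carrier G"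
  using iso hom_carrier[of \<theta> "presented_group n rs" G]
  by (auto simp: ev_def iso_def presented_group_def)

lemma ev_append: "u \<in> words n \<Longrightarrow> v \<in> words n \<Longrightarrow> ev (u @ v) = ev u \<otimes> ev v"
proof -
  assume uv: "u \<in> words n" "v \<in> words n"
  then have "word_class n rs u \<in> carrier (presented_group n rs)"
    "word_class n rs v \<in> carrier (presented_group n rs)"
    by (auto simp: presented_group_def)
  moreover have "\<theta> \<in> hom (presented_group n rs) G"
    using iso by (simp add: iso_def)
  ultimately show ?thesis
    using uv hom_mult[of \<theta> "presented_group n rs" G] mult_presented_group[OF pres]
    unfolding ev_def by metis
qed

lemma ev_surj: "x \<in> carrier G \<Longrightarrow> \<exists>w\<in>words n. ev w = x"
proof -
  assume "x \<in> carrier G"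
  moreover have "\<theta> ` word_class n rs ` words n = carrier G"
    using iso by (simp add: iso_def bij_betw_def presented_group_def)
  ultimately have "x \<in> \<theta> ` word_class n rs ` words n" by simp
  then show ?thesis
    unfolding ev_def by auto
qed

lemma ev_eq_iff:
  "u \<in> words n \<Longrightarrow> v \<in> words n \<Longrightarrow> ev u = ev v \<longleftrightarrow> equivclp (insertion n rs) u v"
  using iso unfolding word_class_eq_iff[symmetric]
  by (auto simp: ev_def iso_def bij_betw_def presented_group_def dest: inj_onD)

lemma ev_Nil: "ev [] = \<one>"
  using ev_append[of "[]" "[]"] r_cancel_one[of "ev []" "ev []"] by simp

lemma ev_relator: "r \<in> set rs \<Longrightarrow> ev r = \<one>"
  using class_relator ev_Nil by (metis ev_def)

lemma ev_inv: "w \<in> words n \<Longrightarrow> ev (inv_word w) = inv (ev w)"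
proof -
  assume w: "w \<in> words n"
  then have "ev w \<otimes> ev (inv_word w) = \<one>"
    using class_cancel[of w n rs] ev_append[of w "inv_word w"] ev_Nil by (simp add: ev_def)
  then have "inv (ev (inv_word w)) = ev w"
    using w by (intro inv_equality) auto
  then show ?thesis
    using w by (metis ev_closed inv_inv inv_word_in_words)
qed

section \<open>Homomorphisms to the integers modulo p\<close>

text \<open>If \<open>p\<close> divides the weight of every relator, this is the kernel of the
  homomorphism to the integers modulo \<open>p\<close> that sends each generator to its value under
  \<open>g\<close>.\<close>

definition mod_kernel :: "int \<Rightarrow> (nat \<Rightarrow> int) \<Rightarrow> 'g set"
  where "mod_kernel p g = ev ` {w \<in> words n. p dvd weight g w}"

context
  fixes p :: int and g :: "nat \<Rightarrow> int"
  assumes g: "\<And>r. r \<in> set rs \<Longrightarrow> p dvd weight g r"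
begin

lemma mem_mod_kernel_iff:
  assumes "w \<in> words n"
  shows "ev w \<in> mod_kernel p g \<longleftrightarrow> p dvd weight g w"
proof
  assume "ev w \<in> mod_kernel p g"
  then obtain w' where w': "w' \<in> words n" "p dvd weight g w'" "ev w = ev w'"
    by (auto simp: mod_kernel_def)
  then have "p dvd weight g w - weight g w'"
    using assms ev_eq_iff by (intro weight_cong_insertion[where rs = rs and n = n] g)
      (auto intro: equivclp_sym)
  then show "p dvd weight g w"
    using w'(2) by (metis dvd_add diff_add_cancel)
qed (use assms in \<open>auto simp: mod_kernel_def\<close>)

lemma subgroup_mod_kernel: "subgroup (mod_kernel p g) G"
proof (rule subgroupI)
  show "mod_kernel p g \<subseteq> carrier G"
    by (auto simp: mod_kernel_def)
  show "mod_kernel p g \<noteq> {}"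
    using mem_mod_kernel_iff[of "[]"] by auto
next
  fix a assume "a \<in> mod_kernel p g"
  then obtain w where "w \<in> words n" "p dvd weight g w" "a = ev w"
    by (auto simp: mod_kernel_def)
  then show "inv a \<in> mod_kernel p g"
    using mem_mod_kernel_iff[of "inv_word w"] by (simp add: ev_inv)
next
  fix a b assume "a \<in> mod_kernel p g" "b \<in> mod_kernel p g"
  then obtain u v where "u \<in> words n" "p dvd weight g u" "a = ev u"
      "v \<in> words n" "p dvd weight g v" "b = ev v"
    by (auto simp: mod_kernel_def)
  then show "a \<otimes> b \<in> mod_kernel p g"
    using mem_mod_kernel_iff[of "u @ v"] by (simp add: ev_append)
qed

text \<open>In a commutator word the contributions of each factor and of its inverse cancel, so its
  weight is 0 for every \<open>g\<close>.\<close>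

lemma derived_subset_mod_kernel: "derived G (carrier G) \<subseteq> mod_kernel p g"
  unfolding derived_def
proof (rule generate_subgroup_incl[OF _ subgroup_mod_kernel], clarsimp)
  fix x y assume "x \<in> carrier G" "y \<in> carrier G"
  then obtain u v where uv: "u \<in> words n" "v \<in> words n" "x = ev u" "y = ev v"
    using ev_surj by metis
  have "ev (u @ v @ inv_word u @ inv_word v) \<in> mod_kernel p g"
    by (subst mem_mod_kernel_iff) (use uv in auto)
  then show "x \<otimes> y \<otimes> inv x \<otimes> inv y \<in> mod_kernel p g"
    using uv by (simp add: ev_append ev_inv m_assoc)
qed

end

end

text \<open>The map from \<open>G\<close> to the free abelian group has the derived subgroup as its
  kernel. A subgroup \<open>K\<close> containing this kernel is all of \<open>G\<close> as soon as
  its image is everything, and for that it suffices that the image contains a basis.\<close>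

lemma (in group) generated_by_lifts:
  assumes iso: "H1 G \<cong> free_Abelian_group I"
  obtains x where "x ` I \<subseteq> carrier G"
    and "\<And>K. subgroup K G \<Longrightarrow> derived G (carrier G) \<subseteq> K \<Longrightarrow> x ` I \<subseteq> K \<Longrightarrow> K = carrier G"
proof -
  interpret D: normal "derived G (carrier G)" G
    by (rule derived_self_is_normal)
  let ?F = "free_Abelian_group I"
  interpret F: group ?F by simp
  obtain \<psi> where \<psi>: "\<psi> \<in> Group.iso (H1 G) ?F"
    using iso by (auto simp: is_iso_def)
  define \<rho> where "\<rho> = \<psi> \<circ> (\<lambda>a. derived G (carrier G) #> a)"
  have \<rho>: "\<rho> \<in> hom G ?F"
    unfolding \<rho>_def using D.r_coset_hom_Mod \<psi> by (auto simp: H1_def iso_def intro: Group.hom_compose)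
  interpret \<rho>: group_hom G ?F \<rho>
    using \<rho> by unfold_locales
  have surj: "\<rho> ` carrier G = carrier ?F"
  proof -
    have "\<psi> ` carrier (H1 G) = carrier ?F"
      using \<psi> by (auto simp: iso_def bij_betw_def)
    then show ?thesis
      by (auto simp: \<rho>_def H1_def FactGroup_def RCOSETS_def image_iff)
  qed
  have ker: "a \<in> derived G (carrier G)" if a: "a \<in> carrier G" "\<rho> a = \<rho> \<one>" for a
  proof -
    have "inj_on \<psi> (carrier (H1 G))"
      using \<psi> by (auto simp: iso_def bij_betw_def)
    then have "derived G (carrier G) #> a = derived G (carrier G) #> \<one>"
      using a by (auto simp: \<rho>_def H1_def FactGroup_def RCOSETS_def dest: inj_onD)
    then show ?thesis
      using a D.subgroup_axioms by (metis coset_mult_one D.subset rcos_self)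
  qed
  have "\<forall>i\<in>I. \<exists>x\<in>carrier G. \<rho> x = frag_of i"
    using surj by (metis frag_of_in_free_Abelian_group imageE)
  then obtain x where x: "\<And>i. i \<in> I \<Longrightarrow> x i \<in> carrier G" "\<And>i. i \<in> I \<Longrightarrow> \<rho> (x i) = frag_of i"
    by metis
  show thesis
  proof
    show "x ` I \<subseteq> carrier G" using x by auto
    fix K assume K: "subgroup K G" "derived G (carrier G) \<subseteq> K" "x ` I \<subseteq> K"
    interpret K: subgroup K G by fact
    have "y \<in> \<rho> ` K" if "Poly_Mapping.keys y \<subseteq> I" for y
      using that
    proof (induction rule: frag_induction)
      case zero
      show ?case using \<rho>.hom_one K.one_closed by (metis imageI one_free_Abelian_group)
    next
      case (one i)
      then show ?case using x K(3) by (metis image_eqI image_subset_iff)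
    next
      case (diff a b)
      then obtain u v where "u \<in> K" "v \<in> K" "a = \<rho> u" "b = \<rho> v" by auto
      then have "\<rho> (u \<otimes> inv v) = a - b" "u \<otimes> inv v \<in> K"
        using \<rho>.hom_closed[of v] by (auto simp: K.mem_carrier)
      then show ?case by (metis imageI)
    qed
    then have sub: "carrier ?F \<subseteq> \<rho> ` K" by auto
    have "a \<in> K" if a: "a \<in> carrier G" for a
    proof -
      obtain b where b: "b \<in> K" "\<rho> b = \<rho> a"
        using sub \<rho>.hom_closed[OF a] by (metis imageE subsetD)
      then have "\<rho> (a \<otimes> inv b) = \<rho> \<one>"
        using a \<rho>.hom_closed[OF a] by (simp add: K.mem_carrier)
      then have "a \<otimes> inv b \<in> K"
        using ker[of "a \<otimes> inv b"] K(2) a b by (auto simp: K.mem_carrier)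
      then have "a \<otimes> inv b \<otimes> b \<in> K"
        using b by blast
      then show ?thesis
        using a b by (simp add: m_assoc K.mem_carrier)
    qed
    then show "K = carrier G" using K.subset by auto
  qed
qed

text \<open>Pigeonhole: there are more weight functions on \<open>n\<close> generators with values
  in \<open>{0..<p}\<close> than tuples of residues on the words \<open>w i\<close>. The difference
  of two colliding functions is the required \<open>g\<close>.\<close>

lemma weights_vanishing_mod:
  fixes p :: int
  assumes p: "p > 1" and I: "finite I" "card I < n"
  obtains g where "\<And>i. i \<in> I \<Longrightarrow> p dvd weight g (w i)" and "\<exists>a<n. \<not> p dvd g a"
proof -
  let ?D = "{..<n} \<rightarrow>\<^sub>E {0..<p}"
  let ?\<Phi> = "\<lambda>f. \<lambda>i\<in>I. weight f (w i) mod p"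
  have "?\<Phi> ` ?D \<subseteq> I \<rightarrow>\<^sub>E {0..<p}"
    by (rule image_subsetI) (use p in \<open>simp add: restrict_PiE_iff\<close>)
  then have "card (?\<Phi> ` ?D) \<le> card (I \<rightarrow>\<^sub>E {0..<p})"
    using I by (intro card_mono finite_PiE) auto
  also have "\<dots> = nat p ^ card I"
    using I by (simp add: card_PiE)
  also have "\<dots> < nat p ^ n"
    using p I by (intro power_strict_increasing) auto
  also have "\<dots> = card ?D"
    by (simp add: card_PiE)
  finally have "\<not> inj_on ?\<Phi> ?D"
    using pigeonhole by blast
  then obtain f f' where f: "f \<in> ?D" "f' \<in> ?D" "f \<noteq> f'" "?\<Phi> f = ?\<Phi> f'"
    by (auto simp: inj_on_def)
  show thesis
  proof
    fix i assume "i \<in> I"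
    then have "weight f (w i) mod p = weight f' (w i) mod p"
      using fun_cong[OF f(4), of i] by simp
    then show "p dvd weight (\<lambda>a. f a - f' a) (w i)"
      by (simp add: weight_diff mod_eq_dvd_iff)
  next
    obtain a where a: "a < n" "f a \<noteq> f' a"
      using f by (metis PiE_ext lessThan_iff)
    then have "f a \<in> {0..<p}" "f' a \<in> {0..<p}"
      using PiE_mem[OF f(1), of a] PiE_mem[OF f(2), of a] by auto
    then have "\<bar>f a - f' a\<bar> < p" by auto
    then have "\<not> p dvd f a - f' a"
      using a p zdvd_not_zless[of "\<bar>f a - f' a\<bar>" p] by auto
    then show "\<exists>a<n. \<not> p dvd f a - f' a"
      using a by blast
  qed
qed

text \<open>If \<open>p\<close> did not divide \<open>U j\<^sub>0\<close>, a homomorphism to \<open>\<int>/p\<close> of the free group killing the other relators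
  would kill the relator \<open>j\<^sub>0\<close> as well. One that also kills lifts of the basis of \<open>H\<^sub>1\<close> would be trivial,
  but these are only \<open>n - 1\<close> linear conditions on the \<open>n\<close> generators.\<close>

lemma (in presented) relators_independent_mod_prime:
  fixes p :: int and U :: "nat \<Rightarrow> int"
  assumes iso: "H1 G \<cong> free_Abelian_group {..<n - length rs}" and n: "length rs \<le> n"
    and p: "prime p"
    and U: "\<And>g. p dvd (\<Sum>j<length rs. U j * weight g (rs ! j))" and j0: "j0 < length rs"
  shows "p dvd U j0"
proof (rule ccontr)
  assume ndvd: "\<not> p dvd U j0"
  define d where "d = n - length rs"
  obtain x where x: "x ` {..<d} \<subseteq> carrier G"
    "\<And>K. subgroup K G \<Longrightarrow> derived G (carrier G) \<subseteq> K \<Longrightarrow> x ` {..<d} \<subseteq> K \<Longrightarrow> K = carrier G"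
    using generated_by_lifts[OF iso] unfolding d_def by blast
  have "\<forall>i<d. \<exists>w\<in>words n. ev w = x i"
    using ev_surj x(1) by auto
  then obtain w where w: "\<And>i. i < d \<Longrightarrow> w i \<in> words n" "\<And>i. i < d \<Longrightarrow> ev (w i) = x i"
    by metis
  define I where "I = (({..<length rs} - {j0}) <+> {..<d})"
  have I: "finite I" "card I < n"
    using j0 n by (auto simp: I_def d_def card_Plus)
  obtain g where g: "\<And>i. i \<in> I \<Longrightarrow> p dvd weight g (case_sum ((!) rs) w i)" "\<exists>a<n. \<not> p dvd g a"
    using weights_vanishing_mod[OF prime_gt_1_int[OF p] I] by metis
  have g1: "p dvd weight g (rs ! j)" if "j < length rs" "j \<noteq> j0" for j
    using g(1)[of "Inl j"] that by (auto simp: I_def)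
  have "(\<Sum>j<length rs. U j * weight g (rs ! j))
      = U j0 * weight g (rs ! j0) + (\<Sum>j\<in>{..<length rs} - {j0}. U j * weight g (rs ! j))"
    using j0 by (simp add: sum.remove)
  moreover have "p dvd (\<Sum>j\<in>{..<length rs} - {j0}. U j * weight g (rs ! j))"
    by (rule dvd_sum) (use g1 in auto)
  ultimately have "p dvd U j0 * weight g (rs ! j0)"
    using U[of g] by (simp add: dvd_add_left_iff)
  then have "p dvd weight g (rs ! j0)"
    using ndvd p by (simp add: prime_dvd_mult_iff)
  then have grs: "p dvd weight g r" if "r \<in> set rs" for r
    using g1 that by (metis in_set_conv_nth)
  have "mod_kernel p g = carrier G"
  proof (rule x(2))
    show "x ` {..<d} \<subseteq> mod_kernel p g"
    proof clarsimp
      fix i assume i: "i < d"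
      then have "p dvd weight g (w i)"
        using g(1)[of "Inr i"] by (auto simp: I_def)
      then show "x i \<in> mod_kernel p g"
        using mem_mod_kernel_iff[OF grs w(1)[OF i]] w(2)[OF i] by simp
    qed
  qed (use subgroup_mod_kernel derived_subset_mod_kernel grs in auto)
  \<comment> \<open>The one-letter words evaluate into the kernel too, so \<open>g\<close> vanishes
    modulo \<open>p\<close> on all generators, contrary to its choice.\<close>
  then have "p dvd g a" if "a < n" for a
    using mem_mod_kernel_iff[OF grs, of "[(a, True)]"] that ev_closed[of "[(a, True)]"] by simp
  then show False using g(2) by blast
qed


section \<open>Homotopies of edge paths\<close>

lemma step_start_inv_letter [simp]: "step_start X (inv_letter x) = step_end X x"
  by (simp add: step_start_def step_end_def)

lemma step_end_inv_letter [simp]: "step_end X (inv_letter x) = step_start X x"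
  by (simp add: step_start_def step_end_def)

lemma is_path_verts: "is_path X u p v \<Longrightarrow> u \<in> verts X \<and> v \<in> verts X"
  by (induction p arbitrary: u) auto

lemma is_path_append:
  "is_path X u (p @ q) v \<longleftrightarrow> (\<exists>w. is_path X u p w \<and> is_path X w q v)"
proof (induction p arbitrary: u)
  case Nil
  then show ?case using is_path_verts by fastforce
qed auto

lemma is_path_edges: "is_path X u p v \<Longrightarrow> fst ` set p \<subseteq> edges X"
  by (induction p arbitrary: u) auto

lemma is_path_concat_replicate:
  "is_path X v p v \<Longrightarrow> is_path X v (concat (replicate m p)) v"
  by (induction m) (auto simp: is_path_append dest: is_path_verts)

lemma path_insertion_append:
  assumes "path_insertion X u v p q" and c: "is_path X a c u" and d: "is_path X v d b"
  shows "path_insertion X a b (c @ p @ d) (c @ q @ d)"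
  using assms(1)
proof cases
  case (backtrack p' w q' x)
  have "is_path X a (c @ p') w" "is_path X w (q' @ d) b"
    using backtrack(3,4) c d unfolding is_path_append by blast+
  then have "path_insertion X a b ((c @ p') @ (q' @ d)) ((c @ p') @ [x, inv_letter x] @ (q' @ d))"
    by (rule path_insertion.backtrack) (use backtrack in auto)
  then show ?thesis
    using backtrack by simp
next
  case (face p' w q' R)
  have "is_path X a (c @ p') w" "is_path X w (q' @ d) b"
    using face(3,4) c d unfolding is_path_append by blast+
  then have "path_insertion X a b ((c @ p') @ (q' @ d)) ((c @ p') @ att X R @ (q' @ d))"
    by (rule path_insertion.face) (use face in auto)
  then show ?thesis
    using face by simp
qed

lemma homotopic_paths_rel_refl: "is_path X u p v \<Longrightarrow> homotopic_paths_rel X u v p p"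
  by (simp add: homotopic_paths_rel_def)

lemma homotopic_paths_rel_sym: "homotopic_paths_rel X u v p q \<Longrightarrow> homotopic_paths_rel X u v q p"
  by (simp add: homotopic_paths_rel_def equivclp_sym[of _ p q])

lemma homotopic_paths_rel_trans:
  "homotopic_paths_rel X u v p q \<Longrightarrow> homotopic_paths_rel X u v q r \<Longrightarrow> homotopic_paths_rel X u v p r"
  unfolding homotopic_paths_rel_def using equivclp_trans[of _ p q r] by simp

text \<open>The two factors are deformed one after the other, each time with the other factor held
  fixed.\<close>

lemma homotopic_paths_rel_append:
  assumes p: "homotopic_paths_rel X u v p p'" and q: "homotopic_paths_rel X v w q q'"
  shows "homotopic_paths_rel X u w (p @ q) (p' @ q')"
proof -
  have pp: "is_path X u p v" "is_path X u p' v" "equivclp (path_insertion X u v) p p'"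
    and qq: "is_path X v q w" "is_path X v q' w" "equivclp (path_insertion X v w) q q'"
    using p q by (auto simp: homotopic_paths_rel_def)
  have u: "is_path X u [] u" and w: "is_path X w [] w"
    using is_path_verts[OF pp(1)] is_path_verts[OF qq(1)] by auto
  have "equivclp (path_insertion X u w) (p @ q) (p' @ q)"
    using equivclp_map[OF pp(3), of "path_insertion X u w" "\<lambda>p. p @ q"]
      path_insertion_append[OF _ u qq(1)] by simp
  moreover have "equivclp (path_insertion X u w) (p' @ q) (p' @ q')"
    using equivclp_map[OF qq(3), of "path_insertion X u w" "\<lambda>q. p' @ q"]
      path_insertion_append[OF _ pp(2) w] by simp
  moreover have "is_path X u (p @ q) w" "is_path X u (p' @ q') w"
    using pp qq by (auto simp: is_path_append)
  ultimately show ?thesis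
    unfolding homotopic_paths_rel_def using equivclp_trans[of _ "p @ q" "p' @ q"] by simp
qed

lemma path_class_eqI:
  assumes "homotopic_paths_rel X v v p q"
  shows "path_class X v p = path_class X v q"
proof -
  have "homotopic_paths_rel X v v p r \<longleftrightarrow> homotopic_paths_rel X v v q r" for r
    using homotopic_paths_rel_trans[OF assms, of r]
      homotopic_paths_rel_trans[OF homotopic_paths_rel_sym[OF assms], of r] by blast
  then show ?thesis by (simp add: path_class_def)
qed

lemma mult_fundamental_group:
  assumes p: "is_path X v p v" and q: "is_path X v q v"
  shows "path_class X v p \<otimes>\<^bsub>fundamental_group X v\<^esub> path_class X v q = path_class X v (p @ q)"
proof -
  have "path_class X v (p' @ q') = path_class X v (p @ q)"
    if "p' \<in> path_class X v p" "q' \<in> path_class X v q" for p' q'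
    using that homotopic_paths_rel_append[of X v v p p' v q q'] path_class_eqI
    by (metis mem_Collect_eq path_class_def)
  then have "(\<Union>p'\<in>path_class X v p. \<Union>q'\<in>path_class X v q. path_class X v (p' @ q'))
      = (\<Union>p'\<in>path_class X v p. \<Union>q'\<in>path_class X v q. path_class X v (p @ q))"
    by (intro SUP_cong refl)
  moreover have "p \<in> path_class X v p" "q \<in> path_class X v q"
    using p q by (auto simp: path_class_def homotopic_paths_rel_refl)
  ultimately show ?thesis
    unfolding fundamental_group_def by (auto simp del: UN_simps)
qed

text \<open>Translates a power in the fundamental group into a repeated edge path, whose cellular
  chain is a multiple.\<close>

lemma pow_fundamental_group:
  assumes "is_path X v p v"
  shows "path_class X v p [^]\<^bsub>fundamental_group X v\<^esub> m = path_class X v (concat (replicate m p))"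
proof (induction m)
  case 0
  show ?case by (simp add: nat_pow_def fundamental_group_def)
next
  case (Suc m)
  \<comment> \<open>\<open>replicate\<close> unfolds at the front, whereas the group power
    multiplies at the back.\<close>
  have "concat (replicate m p) @ p = concat (replicate (Suc m) p)"
    by (simp flip: replicate_append_same)
  then show ?case
    using Suc mult_fundamental_group[OF is_path_concat_replicate[OF assms, of m] assms]
    by (simp add: nat_pow_def)
qed

text \<open>A homotopy changes the cellular chain of a path by a boundary. The 2-chain is encoded as
  a word \<open>L\<close> in the 2-cells, and chains are compared by pairing them with all cochains \<open>f\<close>.\<close>

lemma homotopic_paths_chain:
  assumes "homotopic_paths_rel X u v p q"
  obtains L where "fst ` set L \<subseteq> faces X"
    and "\<And>f. weight f q = weight f p + weight (\<lambda>R. weight f (att X R)) L"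
proof -
  have "equivclp (path_insertion X u v) p q"
    using assms by (simp add: homotopic_paths_rel_def)
  then have "\<exists>L. fst ` set L \<subseteq> faces X \<and>
      (\<forall>f. weight f q = weight f p + weight (\<lambda>R. weight f (att X R)) L)"
  proof induction
    case base
    show ?case by (rule exI[of _ "[]"]) simp
  next
    case (step y z)
    have ins: "\<exists>M. fst ` set M \<subseteq> faces X \<and>
        (\<forall>f. weight f z = weight f y + weight (\<lambda>R. weight f (att X R)) M)"
      if "path_insertion X u v y z" for y z
      using that
    proof cases
      case backtrack
      then show ?thesis by (intro exI[of _ "[]"]) auto
    next
      case (face _ _ _ R)
      then show ?thesis by (intro exI[of _ "[(R, True)]"]) auto
    qed
    obtain L where L: "fst ` set L \<subseteq> faces X"
      "\<forall>f. weight f y = weight f p + weight (\<lambda>R. weight f (att X R)) L"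
      using step.IH by blast
    obtain M where M: "fst ` set M \<subseteq> faces X"
      "\<forall>f. weight f z = weight f y + weight (\<lambda>R. weight f (att X R)) M"
    proof (cases "path_insertion X u v y z")
      case True
      then show ?thesis using ins that by blast
    next
      \<comment> \<open>The homotopy may also delete a boundary path; this is recorded by the
        inverse word of 2-cells.\<close>
      case False
      then obtain M where "fst ` set M \<subseteq> faces X"
        "\<forall>f. weight f y = weight f z + weight (\<lambda>R. weight f (att X R)) M"
        using ins step(2) by blast
      then show ?thesis by (intro that[of "inv_word M"]) auto
    qed
    show ?case
      by (rule exI[of _ "L @ M"]) (use L M in auto)
  qed
  then show thesis using that by blast
qed

text \<open>The exponent of \<open>e\<close> in a path is a homotopy invariant, since \<open>e\<close> is in no boundary of
  a 2-cell of \<open>Y\<close>. If the attaching path of \<open>R\<close> is an \<open>m\<close>-th power and \<open>p\<close> is a prime divisor of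
  \<open>m\<close>, then \<open>R\<close> minus a 2-chain of \<open>Y\<close> is a cycle modulo \<open>p\<close>, with coefficient 1 at \<open>R\<close>.\<close>

lemma simple_Re_elementary_reductionI:
  assumes sub: "subcomplex Y X" and verts: "verts X = verts Y"
    and e: "e \<notin> edges Y" "edges X = insert e (edges Y)"
    and R: "R \<notin> faces Y" "faces X = insert R (faces Y)"
    and exponent: "weight (\<lambda>a. of_bool (a = e)) (att X R) \<noteq> 0"
    and inj: "\<And>p L. prime (p :: int) \<Longrightarrow> fst ` set L \<subseteq> faces X \<Longrightarrow>
      (\<And>f. p dvd weight (\<lambda>S. weight f (att X S)) L) \<Longrightarrow>
      p dvd weight (\<lambda>S. of_bool (S = R)) L"
  shows "simple_Re_elementary_reduction R e X Y"
proof -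
  let ?A = "add_edge e Y"
  have A [simp]: "faces ?A = faces Y" "att ?A = att X" "base ?A = base X" "edges ?A = edges X"
    using sub e by (auto simp: add_edge_def subcomplex_def)
  have "att Y = att X" "two_complex Y"
    using sub by (auto simp: subcomplex_def)
  then have att_Y: "fst ` set (att X S) \<subseteq> edges Y" if "S \<in> faces Y" for S
    using that is_path_edges[of Y "base Y S" "att Y S" "base Y S"] by (auto simp: two_complex_def)
  show ?thesis
    unfolding simple_Re_elementary_reduction_def Re_elementary_reduction_def
  proof (intro conjI notI)
    assume "\<exists>v q. is_path Y v q v \<and> homotopic_closed_paths ?A (base X R) (att X R) v q"
    then obtain v q c where q: "is_path Y v q v"
      and hom: "homotopic_paths_rel ?A (base X R) (base X R) (att X R) (c @ q @ inv_word c)"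
      by (auto simp: homotopic_closed_paths_def)
    let ?f = "\<lambda>a. of_bool (a = e) :: int"
    obtain L where L: "fst ` set L \<subseteq> faces Y"
      "weight ?f (c @ q @ inv_word c) = weight ?f (att X R) + weight (\<lambda>R. weight ?f (att X R)) L"
      using homotopic_paths_chain[OF hom] by (metis A(1,2))
    have "weight (\<lambda>R. weight ?f (att X R)) L = 0"
    proof (rule weight_eq_0)
      fix S assume "S \<in> fst ` set L"
      then have "fst ` set (att X S) \<subseteq> edges Y"
        using L att_Y by blast
      then show "weight ?f (att X S) = 0"
        using e(1) by (intro weight_eq_0) auto
    qed
    moreover have "weight ?f q = 0"
      using is_path_edges[OF q] e(1) by (intro weight_eq_0) auto
    \<comment> \<open>The track \<open>c\<close> of the base point may run through \<open>e\<close>,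
      but its contribution cancels against that of \<open>inv_word c\<close>.\<close>
    ultimately show False
      using L(2) exponent by simp
  next
    assume "proper_power (fundamental_group ?A (base X R)) (path_class ?A (base X R) (att X R))"
    then obtain q m where q: "is_path ?A (base X R) q (base X R)" and m: "m \<ge> (2::nat)"
      and eq: "path_class ?A (base X R) (att X R) = path_class ?A (base X R) q [^]\<^bsub>fundamental_group ?A (base X R)\<^esub> m"
      by (auto simp: proper_power_def fundamental_group_def)
    obtain p where p: "prime p" "p dvd m"
      using m prime_factor_nat[of m] by auto
    have "two_complex X"
      using sub by (simp add: subcomplex_def)
    then have "is_path X (base X R) (att X R) (base X R)"
      using R by (auto simp: two_complex_def)
    \<comment> \<open>Edge paths do not see the 2-cells, and apart from \<open>R\<close> the two
      complexes agree.\<close>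
    moreover have "is_path ?A u w v \<longleftrightarrow> is_path X u w v" for u w v
    proof (induction w arbitrary: u)
      case Nil
      then show ?case using verts by (simp add: add_edge_def)
    next
      case (Cons x w)
      have "step_start ?A x = step_start X x" "step_end ?A x = step_end X x"
        using sub by (auto simp: step_start_def step_end_def add_edge_def subcomplex_def)
      then show ?case using Cons verts by (auto simp: add_edge_def e)
    qed
    ultimately have "att X R \<in> path_class ?A (base X R) (att X R)"
      by (simp add: path_class_def homotopic_paths_rel_refl)
    then have "homotopic_paths_rel ?A (base X R) (base X R) (concat (replicate m q)) (att X R)"
      unfolding eq pow_fundamental_group[OF q] by (simp add: path_class_def)
    then obtain L where L: "fst ` set L \<subseteq> faces Y"
      "\<And>f. weight f (att X R) = int m * weight f q + weight (\<lambda>S. weight f (att X S)) L"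
      using homotopic_paths_chain by (metis A(1,2) weight_concat_replicate)
    have "int p dvd weight (\<lambda>S. of_bool (S = R)) ((R, True) # inv_word L)"
    proof (rule inj)
      show "prime (int p)" using p by simp
      show "fst ` set ((R, True) # inv_word L) \<subseteq> faces X"
        using L R by auto
      show "int p dvd weight (\<lambda>S. weight f (att X S)) ((R, True) # inv_word L)" for f
        using L(2)[of f] p by simp
    qed
    moreover have "weight (\<lambda>S. of_bool (S = R)) L = (0 :: int)"
      using L(1) R(1) by (intro weight_eq_0) auto
    ultimately show False
      using p by simp
  qed (use assms in auto)
qed


section \<open>The infinite cyclic covering\<close>

text \<open>The pair \<open>(a, i)\<close> is the lift of the edge \<open>a\<close> that starts at
  height \<open>i\<close>. An inverse letter read at height \<open>i\<close> therefore runs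
  backwards along the lift that starts at \<open>i - c a\<close>.\<close>

fun lift_word :: "('a \<Rightarrow> int) \<Rightarrow> int \<Rightarrow> 'a word \<Rightarrow> ('a \<times> int) word"
  where
    "lift_word c i [] = []"
  | "lift_word c i ((a, s) # w) = (if s then ((a, i), True) # lift_word c (i + c a) w
       else ((a, i - c a), False) # lift_word c (i - c a) w)"

definition shift :: "int \<Rightarrow> 'a \<times> int \<Rightarrow> 'a \<times> int"
  where "shift t = (\<lambda>(a, i). (a, i + t))"

lemma shift_simps [simp]:
  "shift t (a, i) = (a, i + t)" "fst (shift t x) = fst x" "snd (shift t x) = snd x + t"
  by (auto simp: shift_def split: prod.splits)

lemma lift_word_shift: "lift_word c (i + t) w = map (map_prod (shift t) id) (lift_word c i w)"
proof (induction w arbitrary: i)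
  case (Cons x w)
  then show ?case
    using Cons[of "i + c (fst x)"] Cons[of "i - c (fst x)"]
    by (cases x) (auto simp: algebra_simps)
qed simp

lemma map_lift_word: "map (\<lambda>(e, s). (fst e, s)) (lift_word c i w) = w"
  by (induction w arbitrary: i) auto

lemma fst_fst_set_lift_word: "fst ` fst ` set (lift_word c i w) = fst ` set w"
proof -
  have "fst ` set (map (\<lambda>(e, s). (fst e, s)) (lift_word c i w)) = fst ` set w"
    by (simp only: map_lift_word)
  then show ?thesis
    by (simp add: image_image case_prod_beta)
qed

lemma weight_map: "weight f (map (map_prod h id) w) = weight (f \<circ> h) w"
  by (induction w) auto

lemma weight_lift_word_shift:
  "weight f (lift_word c (i + t) w) = weight (f \<circ> shift t) (lift_word c i w)"
  by (simp add: lift_word_shift weight_map)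

text \<open>A cochain pulled back from the base ignores heights; testing with such cochains amounts
  to setting \<open>t\<close> to 1.\<close>

lemma weight_lift_word_fst: "weight (\<lambda>e. g (fst e)) (lift_word c i w) = weight g w"
  by (induction w arbitrary: i) auto

text \<open>The generator \<open>t\<close> of the deck transformation group acts on 2-chains, with coefficients
  \<open>u\<close>, and the following identity is the division of \<open>\<Sum> u\<^sub>i t\<^sup>i\<close> by \<open>t - 1\<close>.\<close>

lemma abel_summation:
  fixes u d :: "nat \<Rightarrow> int"
  shows "(\<Sum>i<Suc N. u i * d i)
    = (\<Sum>i<Suc N. u i) * d 0 + (\<Sum>i<N. (\<Sum>s\<in>{Suc i..N}. u s) * (d (Suc i) - d i))"
proof (induction N)
  case (Suc N)
  have "(\<Sum>i<Suc N. (\<Sum>s\<in>{Suc i..Suc N}. u s) * (d (Suc i) - d i))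
      = (\<Sum>i<Suc N. ((\<Sum>s\<in>{Suc i..N}. u s) + u (Suc N)) * (d (Suc i) - d i))"
    by (rule sum.cong) auto
  also have "\<dots> = (\<Sum>i<Suc N. (\<Sum>s\<in>{Suc i..N}. u s) * (d (Suc i) - d i))
      + u (Suc N) * (\<Sum>i<Suc N. d (Suc i) - d i)"
    by (simp only: distrib_right sum.distrib sum_distrib_left)
  also have "\<dots> = (\<Sum>i<N. (\<Sum>s\<in>{Suc i..N}. u s) * (d (Suc i) - d i))
      + u (Suc N) * (d (Suc N) - d 0)"
    unfolding sum_lessThan_telescope by simp
  finally show ?case
    using Suc.IH by (simp add: algebra_simps)
qed simp

text \<open>Discrete integration from 0, with the opposite sign to the left of 0. It lets every
  cochain of the covering be written as a difference of a cochain and its translate.\<close>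

lemma antidifference_exists:
  fixes f :: "int \<Rightarrow> int"
  shows "\<exists>F. \<forall>l. F (l + 1) - F l = f l"
proof (intro exI allI)
  fix l :: int
  define F where "F l = (\<Sum>s\<in>{0..<l}. f s) - (\<Sum>s\<in>{l..<0}. f s)" for l
  show "F (l + 1) - F l = f l"
  proof (cases "l \<ge> 0")
    case True
    then have "{0..<l + 1} = insert l {0..<l}" by auto
    then show ?thesis using True by (simp add: F_def)
  next
    case False
    then have "{l..<0} = insert l {l + 1..<0}" by auto
    then show ?thesis using False by (simp add: F_def)
  qed
qed

text \<open>By \<open>indep\<close> the boundary is injective modulo \<open>(p, t - 1)\<close>, so modulo \<open>p\<close> every 2-cycle is divisible
  by \<open>t - 1\<close>, and the quotient is a 2-cycle with smaller support.\<close>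

lemma lifted_boundary_injective:
  fixes p :: int and u :: "nat \<Rightarrow> nat \<Rightarrow> int"
  assumes indep: "\<And>U j. (\<And>g. p dvd (\<Sum>j<k. U j * weight g (r j))) \<Longrightarrow> j < k \<Longrightarrow> p dvd U j"
    and "\<And>f. p dvd (\<Sum>j<k. \<Sum>i<N. u j i * weight f (lift_word c (lo + int i) (r j)))"
    and "j < k" "i < N"
  shows "p dvd u j i"
  using assms(2-)
proof (induction N arbitrary: u j i)
  case (Suc N)
  \<comment> \<open>Division by \<open>t - 1\<close> of the polynomial with coefficients
    \<open>u j\<close>: \<open>U j\<close> is the remainder, its value at 1, and \<open>v j\<close>
    is the quotient, which is one coefficient shorter.\<close>
  define U where "U j = (\<Sum>i<Suc N. u j i)" for j
  define v where "v j i = (\<Sum>s\<in>{Suc i..N}. u j s)" for j i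
  have U: "p dvd U j" if "j < k" for j
  proof (rule indep[OF _ that])
    fix g
    show "p dvd (\<Sum>j<k. U j * weight g (r j))"
      using Suc.prems(1)[of "\<lambda>e. g (fst e)"]
      by (simp only: weight_lift_word_fst U_def sum_distrib_right)
  qed
  have v: "p dvd v j i" if "j < k" "i < N" for j i
  proof (rule Suc.IH[OF _ that])
    fix f :: "'a \<times> int \<Rightarrow> int"
    \<comment> \<open>An arbitrary test cochain \<open>f\<close> for \<open>v\<close> is integrated
      to a cochain for \<open>u\<close>, to which the assumption applies.\<close>
    obtain F where F: "\<And>a l. F a (l + 1) - F a l = f (a, l)"
      using choice[OF allI[OF antidifference_exists], of "\<lambda>a l. f (a, l)"] by blast
    define \<Phi> where "\<Phi> = (\<lambda>(a, l). F a l)"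
    have \<Phi>: "f = (\<lambda>e. (\<Phi> \<circ> shift 1) e - \<Phi> e)"
      by (auto simp: \<Phi>_def F)
    let ?d = "\<lambda>j i. weight \<Phi> (lift_word c (lo + int i) (r j))"
    have d: "weight f (lift_word c (lo + int i) (r j)) = ?d j (Suc i) - ?d j i" for j i
    proof -
      have "?d j (Suc i) = weight (\<Phi> \<circ> shift 1) (lift_word c (lo + int i) (r j))"
        unfolding weight_lift_word_shift[symmetric] by (simp add: algebra_simps)
      then show ?thesis
        unfolding \<Phi> weight_diff by (simp add: o_def)
    qed
    have "(\<Sum>j<k. \<Sum>i<Suc N. u j i * ?d j i)
        = (\<Sum>j<k. U j * ?d j 0) + (\<Sum>j<k. \<Sum>i<N. v j i * (?d j (Suc i) - ?d j i))"
      unfolding abel_summation U_def v_def sum.distrib ..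
    moreover have "p dvd (\<Sum>j<k. U j * ?d j 0)"
      using U by (intro dvd_sum) auto
    ultimately have "p dvd (\<Sum>j<k. \<Sum>i<N. v j i * (?d j (Suc i) - ?d j i))"
      using Suc.prems(1)[of \<Phi>] by (simp only: dvd_add_right_iff)
    then show "p dvd (\<Sum>j<k. \<Sum>i<N. v j i * weight f (lift_word c (lo + int i) (r j)))"
      by (simp only: d)
  qed
  \<comment> \<open>The tail is \<open>U j\<close> for \<open>m = 0\<close>, then
    \<open>v j (m - 1)\<close>, and empty for \<open>m = Suc N\<close>. The coefficient
    \<open>u j i\<close> is a difference of two consecutive tails.\<close>
  have tail: "p dvd (\<Sum>s\<in>{m..N}. u j s)" if m: "m \<le> Suc N" for m
  proof (cases m)
    case 0
    then show ?thesis
      using U[OF Suc.prems(2)] by (simp add: U_def atLeast0AtMost lessThan_Suc_atMost)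
  next
    case (Suc m')
    then show ?thesis
      using v[OF Suc.prems(2), of m'] m by (cases "m' < N") (auto simp: v_def)
  qed
  have "(\<Sum>s\<in>{i..N}. u j s) = u j i + (\<Sum>s\<in>{Suc i..N}. u j s)"
    using Suc.prems(3) by (simp add: sum.atLeast_Suc_atMost)
  then show ?case
    using tail[of i] tail[of "Suc i"] Suc.prems(3) by (simp add: dvd_add_left_iff)
qed simp

section \<open>The covering complex and its edge order\<close>

text \<open>For surjective weights this is the covering that belongs to the kernel of the weight
  homomorphism. The second coordinate of a cell is the height of its source or base point.\<close>

definition cover :: "nat \<Rightarrow> nat word list \<Rightarrow> (nat \<Rightarrow> int) \<Rightarrow>
    (unit \<times> int, nat \<times> int, nat \<times> int) complex2"
  where "cover n rs c =
    \<lparr>verts = UNIV, edges = {..<n} \<times> UNIV, faces = {..<length rs} \<times> UNIV,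
     src = (\<lambda>(a, i). ((), i)), tgt = (\<lambda>(a, i). ((), i + c a)), base = (\<lambda>(j, i). ((), i)),
     att = (\<lambda>(j, i). lift_word c i (rs ! j))\<rparr>"

definition cover_map :: "(unit \<times> int, nat \<times> int, nat \<times> int, unit, nat, nat) cell_map"
  where "cover_map = \<lparr>vmap = fst, emap = fst, fmap = fst\<rparr>"

text \<open>Stated for any \<open>Y\<close> with the vertices and end points of the covering, so
  that it also applies to subcomplexes.\<close>

lemma is_path_lift_word:
  assumes "verts Y = UNIV" "src Y = src (cover n rs c)" "tgt Y = tgt (cover n rs c)"
    and "fst ` set (lift_word c i w) \<subseteq> edges Y"
  shows "is_path Y ((), i) (lift_word c i w) ((), i + weight c w)"
  using assms(4)
proof (induction w arbitrary: i)
  case (Cons x w)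
  obtain a s where x: "x = (a, s)" by force
  show ?case
    using Cons.IH[of "i + c a"] Cons.IH[of "i - c a"] Cons.prems assms(1-3)
    by (auto simp: x step_start_def step_end_def cover_def algebra_simps)
qed (simp add: assms)

text \<open>The interface between algebra and geometry. \<open>key\<close> enumerates the edges in
  order type of the integers, with \<open>n\<close> edges per unit of height, and
  \<open>(\<xi> j, b j)\<close> is the least edge of the lift of relator \<open>j\<close> at height
  0.\<close>

locale ordered_cover =
  fixes n :: nat and rs :: "nat word list" and c :: "nat \<Rightarrow> int"
    and key :: "nat \<times> int \<Rightarrow> int" and \<xi> :: "nat \<Rightarrow> nat" and b :: "nat \<Rightarrow> int"
  assumes pres: "presentation n rs"
    and weight_relator: "r \<in> set rs \<Longrightarrow> weight c r = 0"
    and weight_surj: "\<exists>w\<in>words n. weight c w = d"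
    and indep: "prime (p :: int) \<Longrightarrow> (\<And>g. p dvd (\<Sum>j<length rs. U j * weight g (rs ! j))) \<Longrightarrow>
      j < length rs \<Longrightarrow> p dvd U j"
    and key_bij: "bij_betw key ({..<n} \<times> UNIV) UNIV"
    and key_shift: "key (shift t e) = key e + int n * t"
    and min_inj: "inj_on \<xi> {..<length rs}"
    and min_least: "j < length rs \<Longrightarrow> e \<in> fst ` set (lift_word c 0 (rs ! j)) \<Longrightarrow> e \<noteq> (\<xi> j, b j) \<Longrightarrow>
      key (\<xi> j, b j) < key e"
    and min_exponent: "j < length rs \<Longrightarrow>
      weight (\<lambda>e. of_bool (e = (\<xi> j, b j))) (lift_word c 0 (rs ! j)) \<noteq> 0"
begin

abbreviation "Z \<equiv> cover n rs c"

definition least_edge :: "nat \<times> int \<Rightarrow> nat \<times> int"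
  where "least_edge R = (\<xi> (fst R), b (fst R) + snd R)"

text \<open>A 2-cell is kept exactly when all its boundary edges are, because its least edge
  decides.\<close>

definition upper :: "int \<Rightarrow> (unit \<times> int, nat \<times> int, nat \<times> int) complex2"
  where "upper z = Z\<lparr>edges := {e \<in> edges Z. key e \<ge> z}, faces := {R \<in> faces Z. key (least_edge R) \<ge> z}\<rparr>"

lemma cover_simps [simp]:
  "verts Z = UNIV" "edges Z = {..<n} \<times> UNIV" "faces Z = {..<length rs} \<times> UNIV"
  "src Z (a, i) = ((), i)" "tgt Z (a, i) = ((), i + c a)" "base Z (j, i) = ((), i)"
  "att Z (j, i) = lift_word c i (rs ! j)"
  by (auto simp: cover_def)

lemma upper_simps [simp]:
  "verts (upper z) = UNIV" "edges (upper z) = {e \<in> edges Z. key e \<ge> z}"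
  "faces (upper z) = {R \<in> faces Z. key (least_edge R) \<ge> z}"
  "src (upper z) = src Z" "tgt (upper z) = tgt Z" "base (upper z) = base Z" "att (upper z) = att Z"
  by (auto simp: upper_def)

lemma att_shift: "att Z (j, i) = map (map_prod (shift i) id) (lift_word c 0 (rs ! j))"
  using lift_word_shift[of c 0 i] by simp

lemma least_edge_less:
  assumes "R \<in> faces Z" "e \<in> boundary_edges Z R" "e \<noteq> least_edge R"
  shows "key (least_edge R) < key e"
proof -
  obtain j i where R: "R = (j, i)" "j < length rs" using assms(1) by auto
  have le: "least_edge R = shift i (\<xi> j, b j)" by (simp add: R least_edge_def)
  obtain e' where e': "e' \<in> fst ` set (lift_word c 0 (rs ! j))" "e = shift i e'"
    using assms(2) unfolding R boundary_edges_def att_shift by force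
  then have "e' \<noteq> (\<xi> j, b j)" using assms(3) le by auto
  then show ?thesis
    using min_least[OF R(2) e'(1)] unfolding le e'(2) key_shift by simp
qed

lemma least_edge_exponent:
  assumes "R \<in> faces Z"
  shows "weight (\<lambda>e. of_bool (e = least_edge R)) (att Z R) \<noteq> 0"
proof -
  obtain j i where R: "R = (j, i)" "j < length rs" using assms(1) by auto
  have "weight (\<lambda>e. of_bool (e = least_edge R)) (att Z R)
      = weight (\<lambda>e. of_bool (e = (\<xi> j, b j))) (lift_word c 0 (rs ! j))"
    unfolding R(1) att_shift weight_map
    by (rule weight_cong) (auto simp: least_edge_def)
  then show ?thesis using min_exponent[OF R(2)] by simp
qed

text \<open>An edge that the attaching path misses would have exponent 0 in it.\<close>

lemma least_edge_boundary:
  assumes "R \<in> faces Z"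
  shows "least_edge R \<in> boundary_edges Z R"
proof (rule ccontr)
  assume "least_edge R \<notin> boundary_edges Z R"
  then have "weight (\<lambda>e. of_bool (e = least_edge R)) (att Z R) = (0 :: int)"
    unfolding boundary_edges_def by (intro weight_eq_0) (simp, blast)
  then show False
    using least_edge_exponent[OF assms] by simp
qed

lemma boundary_edges_subset: "R \<in> faces Z \<Longrightarrow> boundary_edges Z R \<subseteq> edges Z"
proof
  fix e assume R: "R \<in> faces Z" and e: "e \<in> boundary_edges Z R"
  obtain j i where ji: "R = (j, i)" "j < length rs" using R by auto
  have "fst e \<in> fst ` fst ` set (lift_word c i (rs ! j))"
    using e ji by (auto simp: boundary_edges_def)
  then have "fst e \<in> fst ` set (rs ! j)"
    unfolding fst_fst_set_lift_word .
  then have "fst e < n"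
    using pres ji(2) by (auto simp: presentation_def words_def dest!: nth_mem)
  then show "e \<in> edges Z" by (cases e) auto
qed

lemma inj_least_edge: "inj_on least_edge (faces Z)"
proof (rule inj_onI)
  fix R S assume *: "R \<in> faces Z" "S \<in> faces Z" "least_edge R = least_edge S"
  then have "fst R = fst S"
    using inj_onD[OF min_inj, of "fst R" "fst S"] by (auto simp: least_edge_def)
  then show "R = S"
    using *(3) by (simp add: least_edge_def prod_eq_iff)
qed

lemma key_eq_iff: "e \<in> edges Z \<Longrightarrow> e' \<in> edges Z \<Longrightarrow> key e = key e' \<longleftrightarrow> e = e'"
  using key_bij by (auto simp: bij_betw_def dest: inj_onD)

text \<open>Lifted attaching paths close up because relators have weight 0.\<close>

lemma two_complex_sub:
  assumes "verts Y = UNIV" "faces Y \<subseteq> faces Z" "src Y = src Z" "tgt Y = tgt Z" "base Y = base Z"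
    "att Y = att Z" "\<And>R. R \<in> faces Y \<Longrightarrow> boundary_edges Z R \<subseteq> edges Y"
  shows "two_complex Y"
  unfolding two_complex_def
proof (intro conjI ballI)
  fix R assume R: "R \<in> faces Y"
  obtain j i where ji: "R = (j, i)" "j < length rs" using R assms(2) by auto
  have "is_path Y ((), i) (lift_word c i (rs ! j)) ((), i + weight c (rs ! j))"
    using assms(1,3,4) assms(7)[OF R] ji
    by (intro is_path_lift_word) (simp_all add: boundary_edges_def)
  then show "is_path Y (base Y R) (att Y R) (base Y R)"
    using assms ji weight_relator by simp
qed (simp_all add: assms)

lemma two_complex_cover: "two_complex Z"
  by (rule two_complex_sub) (use boundary_edges_subset in auto)

lemma two_complex_upper: "two_complex (upper z)"
proof (rule two_complex_sub)
  fix R assume R: "R \<in> faces (upper z)"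
  show "boundary_edges Z R \<subseteq> edges (upper z)"
  proof
    fix e assume e: "e \<in> boundary_edges Z R"
    have "R \<in> faces Z" "key (least_edge R) \<ge> z" using R by auto
    then show "e \<in> edges (upper z)"
      using boundary_edges_subset e least_edge_less[of R e] by (cases "e = least_edge R") auto
  qed
qed auto

lemma subcomplex_upper_cover: "subcomplex (upper z) Z"
  by (auto simp: subcomplex_def two_complex_upper two_complex_cover)

lemma subcomplex_upper: "z' \<le> z \<Longrightarrow> subcomplex (upper z) (upper z')"
  by (auto simp: subcomplex_def two_complex_upper)

text \<open>A 2-chain has finite support, so its heights lie in a window of length \<open>N\<close>
  starting at \<open>lo\<close>. There the injectivity for polynomials in \<open>t\<close>
  applies.\<close>

lemma boundary_injective:
  assumes p: "prime (p :: int)" and L: "fst ` set L \<subseteq> faces Z"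
    and f: "\<And>f. p dvd weight (\<lambda>S. weight f (att Z S)) L" and R: "R \<in> faces Z"
  shows "p dvd weight (\<lambda>S. of_bool (S = R)) L"
proof -
  \<comment> \<open>\<open>R\<close> is included so that \<open>I\<close> is nonempty and the window
    covers the coefficient at \<open>R\<close>.\<close>
  define I where "I = snd ` insert R (fst ` set L)"
  define lo where "lo = Min I"
  define N where "N = Suc (nat (Max I - Min I))"
  have I: "finite I" by (simp add: I_def)
  have window: "\<exists>m<N. i = lo + int m" if "i \<in> I" for i
  proof (intro exI conjI)
    have "Min I \<le> i" "i \<le> Max I" using I that by auto
    then show "nat (i - lo) < N" "i = lo + int (nat (i - lo))"
      by (auto simp: lo_def N_def)
  qed
  define u where "u j m = weight (\<lambda>S. of_bool (S = (j, lo + int m))) L" for j m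
  let ?h = "\<lambda>(j, m). (j :: nat, lo + int m)"
  have sub: "insert R (fst ` set L) \<subseteq> ?h ` ({..<length rs} \<times> {..<N})"
  proof
    fix S assume S: "S \<in> insert R (fst ` set L)"
    then have "snd S \<in> I" by (auto simp: I_def)
    then obtain m where "m < N" "snd S = lo + int m" using window by blast
    moreover have "fst S < length rs" using S L R by auto
    ultimately show "S \<in> ?h ` ({..<length rs} \<times> {..<N})"
      by (intro image_eqI[of _ _ "(fst S, m)"]) (auto simp: prod_eq_iff)
  qed
  have "weight (\<lambda>S. weight f (att Z S)) L
      = (\<Sum>j<length rs. \<Sum>m<N. u j m * weight f (lift_word c (lo + int m) (rs ! j)))" for f
  proof -
    have "weight (\<lambda>S. weight f (att Z S)) L
        = (\<Sum>S\<in>?h ` ({..<length rs} \<times> {..<N}). weight (\<lambda>T. of_bool (T = S)) L * weight f (att Z S))"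
      using sub by (intro weight_eq_sum) auto
    also have "\<dots> = (\<Sum>x\<in>{..<length rs} \<times> {..<N}.
        u (fst x) (snd x) * weight f (lift_word c (lo + int (snd x)) (rs ! fst x)))"
      by (subst sum.reindex) (auto simp: inj_on_def u_def case_prod_beta)
    finally show ?thesis
      by (simp add: sum.cartesian_product case_prod_beta)
  qed
  then have f': "p dvd (\<Sum>j<length rs. \<Sum>m<N. u j m * weight f (lift_word c (lo + int m) (rs ! j)))"
    for f
    using f by metis
  have u: "p dvd u j m" if "j < length rs" "m < N" for j m
    using indep[OF p] f' that
    by (rule lifted_boundary_injective[where r = "(!) rs" and k = "length rs"])
  show ?thesis
    using sub u by (auto simp: u_def)
qed

section \<open>Exhaustion of the covering by upper sets\<close>

lemma edges_upper_insert:
  assumes "e \<in> edges Z"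
  shows "edges (upper (key e)) = insert e (edges (upper (key e + 1)))"
proof (rule Set.set_eqI)
  fix x
  have "key x \<ge> key e \<longleftrightarrow> key x = key e \<or> key x \<ge> key e + 1" by auto
  then show "x \<in> edges (upper (key e)) \<longleftrightarrow> x \<in> insert e (edges (upper (key e + 1)))"
    using key_eq_iff[of x e] assms by (auto simp del: cover_simps)
qed

lemma faces_upper:
  "faces (upper z) = {R \<in> faces Z. key (least_edge R) = z} \<union> faces (upper (z + 1))"
proof (rule Set.set_eqI)
  fix R
  have "key (least_edge R) \<ge> z \<longleftrightarrow> key (least_edge R) = z \<or> key (least_edge R) \<ge> z + 1" by auto
  then show "R \<in> faces (upper z)
      \<longleftrightarrow> R \<in> {R \<in> faces Z. key (least_edge R) = z} \<union> faces (upper (z + 1))"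
    by (auto simp del: cover_simps)
qed

text \<open>Keys of edges and least edges of 2-cells are both injective, so lowering the bound to
  the key of the least edge of \<open>R\<close> adds this edge and \<open>R\<close> only.\<close>

lemma upper_step_Re:
  assumes R: "R \<in> faces Z"
  shows "simple_Re_elementary_reduction R (least_edge R) (upper (key (least_edge R)))
    (upper (key (least_edge R) + 1))"
proof (rule simple_Re_elementary_reductionI)
  let ?e = "least_edge R"
  have e: "?e \<in> edges Z"
    using least_edge_boundary boundary_edges_subset R by blast
  show "subcomplex (upper (key ?e + 1)) (upper (key ?e))"
    by (rule subcomplex_upper) simp
  show "edges (upper (key ?e)) = insert ?e (edges (upper (key ?e + 1)))"
    using e by (rule edges_upper_insert)
  have "key (least_edge S) = key ?e \<longleftrightarrow> S = R" if "S \<in> faces Z" for S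
  proof -
    have "least_edge S \<in> edges Z"
      using least_edge_boundary boundary_edges_subset that by blast
    then show ?thesis
      using key_eq_iff[OF _ e, of "least_edge S"] inj_onD[OF inj_least_edge _ that R] by auto
  qed
  then show "faces (upper (key ?e)) = insert R (faces (upper (key ?e + 1)))"
    unfolding faces_upper[of "key ?e"] using R by (auto simp del: cover_simps upper_simps)
  show "weight (\<lambda>a. of_bool (a = ?e)) (att (upper (key ?e)) R) \<noteq> 0"
    using least_edge_exponent[OF R] by simp
  show "p dvd weight (\<lambda>S. of_bool (S = R)) L"
    if "prime p" "fst ` set L \<subseteq> faces (upper (key ?e))"
      "\<And>f. p dvd weight (\<lambda>S. weight f (att (upper (key ?e)) S)) L" for p :: int and L
    by (rule boundary_injective) (use that R in auto)
qed auto

text \<open>Every integer is the key of an edge. If this edge is the least edge of no 2-cell, it is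
  attached alone.\<close>

lemma upper_step: "simple_elementary_reduction (upper z) (upper (z + 1))"
proof (cases "\<exists>R\<in>faces Z. key (least_edge R) = z")
  case True
  then show ?thesis
    using upper_step_Re unfolding simple_elementary_reduction_def by metis
next
  case False
  obtain e where e: "e \<in> edges Z" "key e = z"
    using key_bij by (metis UNIV_I bij_betw_iff_bijections cover_simps(2))
  have "e_elementary_reduction e (upper z) (upper (z + 1))"
    unfolding e_elementary_reduction_def
  proof (intro conjI)
    show "subcomplex (upper (z + 1)) (upper z)" by (rule subcomplex_upper) simp
    show "edges (upper z) = insert e (edges (upper (z + 1)))"
      using edges_upper_insert[OF e(1)] e(2) by simp
    show "faces (upper z) = faces (upper (z + 1))"
      unfolding faces_upper[of z] using False by blast
  qed (use e in auto)
  then show ?thesis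
    unfolding simple_elementary_reduction_def by blast
qed

text \<open>Lowering the bound by one in each step reaches every integer key after finitely many
  steps, so the infinite chain exhausts the covering.\<close>

lemma simple_reduction_upper: "simple_reduction Z (upper z)"
  unfolding simple_reduction_def
proof (intro conjI exI)
  let ?C = "\<lambda>i. upper (z - int i)"
  show "?C 0 = upper z" by simp
  show "\<forall>i. enat i \<le> \<infinity> \<longrightarrow> subcomplex (?C i) Z"
    using subcomplex_upper_cover by simp
  show "\<forall>i. enat i < \<infinity> \<longrightarrow> simple_elementary_reduction (?C (Suc i)) (?C i)"
  proof (intro allI impI)
    fix i
    have "z - int (Suc i) + 1 = z - int i" by simp
    then show "simple_elementary_reduction (?C (Suc i)) (?C i)"
      using upper_step[of "z - int (Suc i)"] by metis
  qed
  have key: "\<exists>i. z - int i \<le> y" for y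
    by (rule exI[of _ "nat (z - y)"]) simp
  show "verts Z = (\<Union>i\<in>{i. enat i \<le> \<infinity>}. verts (?C i))" by simp
  show "edges Z = (\<Union>i\<in>{i. enat i \<le> \<infinity>}. edges (?C i))" using key by auto
  show "faces Z = (\<Union>i\<in>{i. enat i \<le> \<infinity>}. faces (?C i))" using key by auto
qed (rule two_complex_cover)

section \<open>Connectedness and deck transformations\<close>

lemma connected_cover: "connected_complex Z"
  unfolding connected_complex_def
proof (intro conjI ballI)
  fix x y :: "unit \<times> int"
  obtain w where w: "w \<in> words n" "weight c w = snd y - snd x"
    using weight_surj by blast
  have "fst ` set (lift_word c (snd x) w) \<subseteq> edges Z"
  proof
    fix e assume "e \<in> fst ` set (lift_word c (snd x) w)"
    then have "fst e \<in> fst ` fst ` set (lift_word c (snd x) w)"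
      by (rule imageI)
    then have "fst e \<in> fst ` set w"
      unfolding fst_fst_set_lift_word .
    then show "e \<in> edges Z"
      using w(1) by (cases e) (auto simp: words_def)
  qed
  then have "is_path Z ((), snd x) (lift_word c (snd x) w) ((), snd x + weight c w)"
    by (intro is_path_lift_word) auto
  then have "is_path Z x (lift_word c (snd x) w) y"
    using w(2) by (cases x; cases y) auto
  then show "\<exists>p. is_path Z x p y" ..
qed simp

lemma covering_cover: "covering Z (standard_complex n rs) cover_map"
  unfolding covering_def
proof (intro conjI ballI)
  show "two_complex (standard_complex n rs)"
  proof -
    have "is_path (standard_complex n rs) () w ()" if "w \<in> words n" for w
      using that by (induction w) (auto simp: standard_complex_def)
    moreover have "rs ! j \<in> words n" if "j < length rs" for j
      using that pres by (auto simp: presentation_def dest: nth_mem)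
    ultimately show ?thesis
      by (simp add: two_complex_def) (simp add: standard_complex_def)
  qed
  show "combinatorial_map Z (standard_complex n rs) cover_map"
    by (auto simp: combinatorial_map_def cover_map_def standard_complex_def map_lift_word)
next
  fix z and d assume "z \<in> verts Z" "d \<in> edges (standard_complex n rs)"
  then have d: "d < n" by (simp add: standard_complex_def)
  obtain i where z: "z = ((), i)" by (cases z) auto
  show "src (standard_complex n rs) d = vmap cover_map z \<longrightarrow>
      (\<exists>!e. e \<in> edges Z \<and> src Z e = z \<and> emap cover_map e = d)"
    using d by (auto simp: z cover_map_def intro!: ex1I[of _ "(d, i)"])
  \<comment> \<open>The lift of \<open>d\<close> that ends at height \<open>i\<close> starts at
    \<open>i - c d\<close>.\<close>
  show "tgt (standard_complex n rs) d = vmap cover_map z \<longrightarrow>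
      (\<exists>!e. e \<in> edges Z \<and> tgt Z e = z \<and> emap cover_map e = d)"
    using d by (auto simp: z cover_map_def intro!: ex1I[of _ "(d, i - c d)"])
next
  fix z and S assume "z \<in> verts Z" "S \<in> faces (standard_complex n rs)"
  then have S: "S < length rs" by (simp add: standard_complex_def)
  obtain i where z: "z = ((), i)" by (cases z) auto
  show "base (standard_complex n rs) S = vmap cover_map z \<longrightarrow>
      (\<exists>!R. R \<in> faces Z \<and> base Z R = z \<and> fmap cover_map R = S)"
    using S by (auto simp: z cover_map_def intro!: ex1I[of _ "(S, i)"])
qed (auto simp: two_complex_cover cover_map_def standard_complex_def)

text \<open>The restrictions make the components extensional, as membership in \<open>Bij\<close>
  demands.\<close>

definition deck :: "int \<Rightarrow> (unit \<times> int, nat \<times> int, nat \<times> int, unit \<times> int, nat \<times> int, nat \<times> int) cell_map"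
  where "deck t = \<lparr>vmap = restrict (shift t) (verts Z), emap = restrict (shift t) (edges Z),
    fmap = restrict (shift t) (faces Z)\<rparr>"

lemma shift_Bij: "restrict (shift t) (A \<times> UNIV) \<in> Bij (A \<times> UNIV)"
  unfolding Bij_def
proof (intro IntI CollectI)
  show "bij_betw (restrict (shift t) (A \<times> UNIV)) (A \<times> UNIV) (A \<times> UNIV)"
    by (rule bij_betw_byWitness[of _ "shift (- t)"]) auto
qed simp

lemma deck_in_deck_group: "deck t \<in> carrier (deck_group Z cover_map)"
proof -
  have "map (\<lambda>(e, s). (restrict (shift t) (edges Z) e, s)) (att Z R) = att Z (shift t R)"
    if "R \<in> faces Z" for R
  proof -
    obtain j i where ji: "R = (j, i)" by force
    have "map (\<lambda>(e, s). (restrict (shift t) (edges Z) e, s)) (att Z R)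
        = map (map_prod (shift t) id) (att Z R)"
      using boundary_edges_subset[OF that] by (auto simp: boundary_edges_def)
    then show ?thesis
      by (simp add: ji lift_word_shift)
  qed
  then have "combinatorial_map Z Z (deck t)"
    by (auto simp: combinatorial_map_def deck_def simp del: cover_simps(7))
  moreover have "vmap (deck t) \<in> Bij (verts Z)" "emap (deck t) \<in> Bij (edges Z)"
    "fmap (deck t) \<in> Bij (faces Z)"
    using shift_Bij[of t UNIV] shift_Bij[of t "{..<n}"] shift_Bij[of t "{..<length rs}"]
    by (auto simp: deck_def)
  ultimately show ?thesis
    by (auto simp: deck_group_def cover_map_def deck_def)
qed

text \<open>The action \<open>h\<close> on heights commutes with adding the weight of a generator,
  hence of any word. As all integers are weights, \<open>h\<close> is a translation, and it
  determines the images of edges and 2-cells through their sources and base points.\<close>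

lemma deck_group_cases:
  assumes "g \<in> carrier (deck_group Z cover_map)"
  obtains t where "g = deck t"
proof -
  have comb: "combinatorial_map Z Z g"
    and ext: "vmap g \<in> extensional (verts Z)" "emap g \<in> extensional (edges Z)"
      "fmap g \<in> extensional (faces Z)"
    and emap: "\<And>e. e \<in> edges Z \<Longrightarrow> fst (emap g e) = fst e"
    and fmap: "\<And>R. R \<in> faces Z \<Longrightarrow> fst (fmap g R) = fst R"
    using assms by (auto simp: deck_group_def cover_map_def Bij_def)
  define h where "h i = snd (vmap g ((), i))" for i
  have vmap: "vmap g ((), i) = ((), h i)" for i
    by (cases "vmap g ((), i)") (simp add: h_def)
  have emap_eq: "emap g (a, i) = (a, h i)" and h: "h (i + c a) = h i + c a" if "a < n" for a i
  proof -
    have e: "(a, i) \<in> edges Z" using that by simp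
    have "src Z (emap g (a, i)) = vmap g (src Z (a, i))"
      "tgt Z (emap g (a, i)) = vmap g (tgt Z (a, i))"
      using comb e unfolding combinatorial_map_def by blast+
    then show "emap g (a, i) = (a, h i)" "h (i + c a) = h i + c a"
      using emap[OF e] by (cases "emap g (a, i)"; auto simp: vmap)+
  qed
  have "h (i + weight c w) = h i + weight c w" if "w \<in> words n" for w i
    using that
  proof (induction w arbitrary: i)
    case (Cons x w)
    have "h (i - c (fst x)) = h i - c (fst x)"
      using h[of "fst x" "i - c (fst x)"] Cons.prems by simp
    then show ?case
      using Cons.IH[of "i + c (fst x)"] Cons.IH[of "i - c (fst x)"] h[of "fst x" i] Cons.prems
      by (auto simp: algebra_simps)
  qed simp
  then have h0: "h d = d + h 0" for d
    using weight_surj[of d] by (metis add.commute add_0)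
  have "vmap g = vmap (deck (h 0))"
    by (rule extensionalityI[OF ext(1)]) (auto simp: deck_def vmap intro: h0)
  moreover have "emap g = emap (deck (h 0))"
  proof (rule extensionalityI[OF ext(2)])
    fix e assume "e \<in> edges Z"
    then show "emap g e = emap (deck (h 0)) e"
      using emap_eq[of "fst e" "snd e"] h0[of "snd e"] by (cases e) (auto simp: deck_def)
  qed (simp add: deck_def)
  moreover have "fmap g = fmap (deck (h 0))"
  proof (rule extensionalityI[OF ext(3)])
    fix R assume R: "R \<in> faces Z"
    then have "base Z (fmap g R) = vmap g (base Z R)"
      using comb unfolding combinatorial_map_def by blast
    then show "fmap g R = fmap (deck (h 0)) R"
      using fmap[OF R] R h0[of "snd R"] by (cases R; cases "fmap g R") (auto simp: deck_def vmap)
  qed (simp add: deck_def)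
  ultimately have "g = deck (h 0)" by simp
  then show thesis by (rule that)
qed

lemma deck_iso: "deck \<in> iso integer_group (deck_group Z cover_map)"
proof (rule isoI)
  show "deck \<in> hom integer_group (deck_group Z cover_map)"
  proof (rule homI)
    fix s t
    have "compose (A \<times> UNIV) (restrict (shift s) (A \<times> UNIV)) (restrict (shift t) (A \<times> UNIV))
        = restrict (shift (s + t)) (A \<times> UNIV)" for A :: "'b set"
      by (auto simp: compose_def fun_eq_iff)
    from this[of "UNIV :: unit set"] this[of "{..<n}"] this[of "{..<length rs}"]
    show "deck (s \<otimes>\<^bsub>integer_group\<^esub> t) = deck s \<otimes>\<^bsub>deck_group Z cover_map\<^esub> deck t"
      by (simp add: deck_def deck_group_def)
  qed (rule deck_in_deck_group)
  have "s = t" if "deck s = deck t" for s t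
  proof -
    have "vmap (deck s) ((), 0) = vmap (deck t) ((), 0)" using that by simp
    then show ?thesis by (simp add: deck_def)
  qed
  then show "bij_betw deck (carrier integer_group) (carrier (deck_group Z cover_map))"
    using deck_in_deck_group deck_group_cases by (auto simp: bij_betw_def inj_on_def image_iff) metis
qed

lemma H_covering_cover: "H_covering integer_group Z (standard_complex n rs) cover_map"
  unfolding H_covering_def
proof (intro conjI ballI impI)
  fix z z' :: "unit \<times> int"
  have "vmap (deck (snd z' - snd z)) z = z'"
    by (cases z; cases z') (simp add: deck_def)
  then show "\<exists>g\<in>carrier (deck_group Z cover_map). vmap g z = z'"
    using deck_in_deck_group by blast
  show "deck_group Z cover_map \<cong> integer_group"
    using deck_iso group.iso_sym[OF group_integer_group] by (auto simp: is_iso_def)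
qed (rule covering_cover connected_cover)+

text \<open>As \<open>key\<close> is injective on the edges, this preorder is a linear order of
  them.\<close>

definition edge_order :: "((nat \<times> int) \<times> (nat \<times> int)) set"
  where "edge_order = {(e, e'). e \<in> edges Z \<and> e' \<in> edges Z \<and> key e \<le> key e'}"

lemma strictly_less_edge_order:
  "e \<in> edges Z \<Longrightarrow> e' \<in> edges Z \<Longrightarrow> strictly_less edge_order e e' \<longleftrightarrow> key e < key e'"
  by (auto simp: strictly_less_def edge_order_def)

lemma is_min_edge_iff:
  assumes R: "R \<in> faces Z"
  shows "is_min_edge edge_order Z R e \<longleftrightarrow> e = least_edge R"
proof -
  note b = boundary_edges_subset[OF R]
  have "is_min_edge edge_order Z R (least_edge R)"
    using least_edge_boundary[OF R] least_edge_less[OF R] b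
      strictly_less_edge_order[of "least_edge R"]
    unfolding is_min_edge_def by blast
  moreover have "e = least_edge R" if e: "is_min_edge edge_order Z R e"
  proof (rule ccontr)
    assume ne: "e \<noteq> least_edge R"
    then have "e \<in> boundary_edges Z R" "strictly_less edge_order e (least_edge R)"
      using e least_edge_boundary[OF R] unfolding is_min_edge_def by auto
    then show False
      using least_edge_less[OF R, of e] ne by (auto simp: strictly_less_def edge_order_def)
  qed
  ultimately show ?thesis by blast
qed

lemma min_edge_eq: "R \<in> faces Z \<Longrightarrow> min_edge edge_order Z R = least_edge R"
  by (simp add: min_edge_def is_min_edge_iff)

theorem weakly_slim_standard_complex: "weakly_slim integer_group (standard_complex n rs)"
  unfolding weakly_slim_def
proof (rule exI[of _ Z], rule exI[of _ cover_map], rule exI[of _ edge_order], intro conjI ballI impI)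
  show "H_covering integer_group Z (standard_complex n rs) cover_map"
    by (rule H_covering_cover)
  show "preorder_on (edges Z) edge_order"
    unfolding preorder_on_def edge_order_def by (auto simp: refl_on_def trans_def)
next
  fix g e e'
  assume g: "g \<in> carrier (deck_group Z cover_map)" and e: "e \<in> edges Z" "e' \<in> edges Z"
  obtain t where t: "g = deck t"
    using deck_group_cases[OF g] .
  have "emap g e = shift t e" "emap g e' = shift t e'" "shift t e \<in> edges Z" "shift t e' \<in> edges Z"
    using e by (auto simp: t deck_def)
  then show "(e, e') \<in> edge_order \<longleftrightarrow> (emap g e, emap g e') \<in> edge_order"
    using e by (simp only: edge_order_def mem_Collect_eq case_prod_conv key_shift) simp
next
  fix R assume R: "R \<in> faces Z"
  show "\<exists>!e. is_min_edge edge_order Z R e"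
    by (simp add: is_min_edge_iff[OF R])
  \<comment> \<open>\<open>W\<close> and \<open>T\<close> are the upper sets bounded by the key of
    the least edge and by its successor.\<close>
  show "\<exists>W T. subcomplex W Z \<and> simple_reduction Z W \<and>
      simple_Re_elementary_reduction R (min_edge edge_order Z R) W T"
    unfolding min_edge_eq[OF R]
    using subcomplex_upper_cover simple_reduction_upper upper_step_Re[OF R] by blast
next
  fix R1 R2
  assume R: "R1 \<in> faces Z" "R2 \<in> faces Z"
    and "R1 \<noteq> R2 \<and> min_edge edge_order Z R1 \<in> boundary_edges Z R2"
  \<comment> \<open>Distinct 2-cells have distinct least edges, so \<open>least_edge R1\<close> is a
    non-minimal edge of \<open>R2\<close>.\<close>
  then have "least_edge R1 \<in> boundary_edges Z R2" "least_edge R1 \<noteq> least_edge R2"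
    using inj_least_edge by (auto simp: min_edge_eq dest: inj_onD simp del: cover_simps)
  then have "key (least_edge R2) < key (least_edge R1)"
    using least_edge_less R by blast
  moreover have "least_edge R1 \<in> edges Z" "least_edge R2 \<in> edges Z"
    using least_edge_boundary boundary_edges_subset R by blast+
  ultimately show "strictly_less edge_order (min_edge edge_order Z R2) (min_edge edge_order Z R1)"
    using R by (simp add: min_edge_eq strictly_less_edge_order del: cover_simps)
qed

end


section \<open>Lowest edges of the lifted relators\<close>

lemma nth_lift_word:
  "q < length w \<Longrightarrow> lift_word c i w ! q =
    ((fst (w ! q), i + weight c (take q w) + (if snd (w ! q) then 0 else - c (fst (w ! q)))), snd (w ! q))"
proof (induction w arbitrary: i q)
  case (Cons x w)
  then show ?case by (cases x; cases q) auto
qed simp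

lemma length_lift_word [simp]: "length (lift_word c i w) = length w"
  by (induction w arbitrary: i) auto

text \<open>The height of the lower end point. The minimum with 0 covers negative weights, so the
  covering itself need not be reoriented.\<close>

definition level :: "('a \<Rightarrow> int) \<Rightarrow> 'a \<times> int \<Rightarrow> int"
  where "level c e = snd e + min 0 (c (fst e))"

lemma level_lift_word:
  assumes "q < length w"
  shows "level c (fst (lift_word c 0 w ! q)) = min (weight c (take q w)) (weight c (take (Suc q) w))"
  using assms by (auto simp: level_def nth_lift_word take_Suc_conv_app_nth min_def)

lemma weight_reorient: "weight (\<lambda>a. \<bar>c a\<bar>) (reorient c w) = weight c w"
  by (induction w) (auto simp: reorient_def split: if_splits)

lemma length_reorient [simp]: "length (reorient c w) = length w"
  by (simp add: reorient_def)

lemma take_reorient: "take i (reorient c w) = reorient c (take i w)"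
  by (simp add: reorient_def take_map)

lemma min_weight_reorient: "min_weight (\<lambda>a. \<bar>c a\<bar>) (reorient c w) = min_weight c w"
  by (simp add: min_weight_def take_reorient weight_reorient)

text \<open>The empty initial subword, which is not among those of \<open>min_weight\<close>, has the same weight
  as the whole relator.\<close>

lemma min_weight_le:
  assumes "weight c w = 0" "w \<noteq> []" "q \<le> length w"
  shows "min_weight c w \<le> weight c (take q w)"
proof -
  have le: "min_weight c w \<le> weight c (take i w)" if "i \<in> {1..length w}" for i
    unfolding min_weight_def using that by (intro Min_le) auto
  show ?thesis
    using le[of q] le[of "length w"] assms by (cases q) (auto simp: Suc_le_eq)
qed

text \<open>After reorientation a positive letter climbs and a negative one descends (weakly). The
  condition of \<open>minima\<close> says that a positive letter starts, respectively a negative one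
  ends, at the minimum: in both cases the edge has its lower end point there.\<close>

lemma minima_reorient:
  assumes "weight c w = 0"
  shows "minima (\<lambda>a. \<bar>c a\<bar>) (reorient c w)
    = mset (map ((!) (reorient c w)) (filter (\<lambda>q. level c (fst (lift_word c 0 w ! q)) = min_weight c w)
        [0..<length w]))"
proof -
  have "weight (\<lambda>a. \<bar>c a\<bar>) (take (Suc q) (reorient c w)) = min_weight c w +
        (if snd (reorient c w ! q) then \<bar>c (fst (reorient c w ! q))\<bar> else 0)
      \<longleftrightarrow> level c (fst (lift_word c 0 w ! q)) = min_weight c w" if q: "q < length w" for q
    using q unfolding take_reorient weight_reorient level_lift_word[OF q]
    by (auto simp: reorient_def take_Suc_conv_app_nth min_def case_prod_beta)
  then show ?thesis
    unfolding minima_def min_weight_reorient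
    by (intro arg_cong[of _ _ mset] arg_cong[of _ _ "map _"] filter_cong) auto
qed

definition lowest_edges :: "('a \<Rightarrow> int) \<Rightarrow> 'a word \<Rightarrow> ('a \<times> int) set"
  where "lowest_edges c w = {e \<in> fst ` set (lift_word c 0 w). level c e = min_weight c w}"

lemma level_ge_min_weight:
  assumes "weight c w = 0" "e \<in> fst ` set (lift_word c 0 w)"
  shows "level c e \<ge> min_weight c w"
proof -
  obtain q where q: "q < length w" "e = fst (lift_word c 0 w ! q)"
    using assms(2) by (auto simp: in_set_conv_nth)
  moreover have "w \<noteq> []" using q by auto
  ultimately show ?thesis
    using min_weight_le[OF assms(1), of q] min_weight_le[OF assms(1), of "Suc q"]
    by (simp add: level_lift_word)
qed

lemma fst_minima_reorient:
  assumes "weight c w = 0"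
  shows "fst ` set_mset (minima (\<lambda>a. \<bar>c a\<bar>) (reorient c w)) = fst ` lowest_edges c w"
proof -
  have "fst (reorient c w ! q) = fst (fst (lift_word c 0 w ! q))" if "q < length w" for q
    using that by (simp add: nth_lift_word reorient_def case_prod_beta)
  then have "fst ` set_mset (minima (\<lambda>a. \<bar>c a\<bar>) (reorient c w))
      = (\<lambda>q. fst (fst (lift_word c 0 w ! q))) `
          {q. q < length w \<and> level c (fst (lift_word c 0 w ! q)) = min_weight c w}"
    unfolding minima_reorient[OF assms] by (auto simp: image_image intro!: image_cong)
  also have "\<dots> = fst ` lowest_edges c w"
    by (force simp: lowest_edges_def in_set_conv_nth image_iff)
  finally show ?thesis .
qed

text \<open>On a given level each generator has just one lift, so all copies of a generator among
  the minima are traversals of a single edge.\<close>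

lemma lowest_edges_unique:
  "(a, i) \<in> lowest_edges c w \<Longrightarrow> i = min_weight c w - min 0 (c a)"
  by (simp add: lowest_edges_def level_def)

lemma weight_of_bool_eq_count:
  "weight (\<lambda>a. of_bool (a = x)) w = int (count (mset w) (x, True)) - int (count (mset w) (x, False))"
  by (induction w) auto

lemma count_mset_map: "count (mset (map f xs)) y = length (filter (\<lambda>x. f x = y) xs)"
  by (induction xs) auto

text \<open>The copies of \<open>x\<close> among the minima are precisely the traversals of its lift
  on the lowest level. The difference of the two counts is the exponent of this edge up to sign,
  which changes if \<open>c x\<close> is negative.\<close>

lemma count_minima_reorient:
  fixes c :: "'a \<Rightarrow> int" and x :: 'a
  assumes "weight c w = 0"
  defines "M \<equiv> minima (\<lambda>a. \<bar>c a\<bar>) (reorient c w)"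
  assumes "count M (x, True) \<noteq> count M (x, False)"
  shows "weight (\<lambda>e. of_bool (e = (x, min_weight c w - min 0 (c x)))) (lift_word c 0 w) \<noteq> 0"
proof -
  let ?x = "(x, min_weight c w - min 0 (c x))"
  have M: "count M (x, s) = card {q. q < length w \<and> level c (fst (lift_word c 0 w ! q)) = min_weight c w
      \<and> reorient c w ! q = (x, s)}" for s
  proof -
    have "count M (x, s) = length (filter (\<lambda>q. reorient c w ! q = (x, s))
        (filter (\<lambda>q. level c (fst (lift_word c 0 w ! q)) = min_weight c w) [0..<length w]))"
      unfolding M_def minima_reorient[OF assms(1)] by (rule count_mset_map)
    also have "\<dots> = card {q. q < length w \<and> level c (fst (lift_word c 0 w ! q)) = min_weight c w
        \<and> reorient c w ! q = (x, s)}"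
      by (subst distinct_card[symmetric]) (auto intro: arg_cong[of _ _ card])
    finally show ?thesis .
  qed
  have L: "count (mset (lift_word c 0 w)) (?x, s) = card {q. q < length w \<and> lift_word c 0 w ! q = (?x, s)}" for s
    using count_mset_map[of "\<lambda>z. z" "lift_word c 0 w" "(?x, s)"] by (simp only: list.map_ident length_filter_conv_card length_lift_word)
  have "level c (fst (lift_word c 0 w ! q)) = min_weight c w \<and> reorient c w ! q = (x, s)
      \<longleftrightarrow> lift_word c 0 w ! q = (?x, if c x < 0 then \<not> s else s)" if "q < length w" for q s
    using that by (auto simp: level_def nth_lift_word reorient_def case_prod_beta prod_eq_iff)
  then have "count M (x, s) = count (mset (lift_word c 0 w)) (?x, if c x < 0 then \<not> s else s)" for s
    unfolding M L by (intro arg_cong[of _ _ card] Collect_cong conj_cong refl)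
  from this[of True] this[of False] show ?thesis
    using assms(3) unfolding weight_of_bool_eq_count by (auto split: if_splits)
qed


section \<open>Weakly concatenable relators\<close>

text \<open>\<open>rk\<close> inverts \<open>y\<close> on its image and maps the remaining numbers
  bijectively onto \<open>{k..<n}\<close>.\<close>

lemma bij_betw_extend_inj:
  assumes "inj_on y {..<k}" "y ` {..<k} \<subseteq> {..<n :: nat}"
  obtains rk where "bij_betw rk {..<n} {..<n}" "\<And>j. j < k \<Longrightarrow> rk (y j) = j"
proof -
  have "k \<le> n"
    using card_inj_on_le[OF assms] by simp
  have "card ({..<n} - y ` {..<k}) = card {k..<n}"
    using assms by (simp add: card_Diff_subset finite_subset card_image)
  then obtain h where h: "bij_betw h ({..<n} - y ` {..<k}) {k..<n}"
    using finite_same_card_bij[of "{..<n} - y ` {..<k}" "{k..<n}"] by auto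
  define rk where "rk a = (if a \<in> y ` {..<k} then inv_into {..<k} y a else h a)" for a
  have "bij_betw (inv_into {..<k} y) (y ` {..<k}) {..<k}"
    using assms(1) by (simp add: bij_betw_inv_into inj_on_imp_bij_betw)
  then have 1: "bij_betw rk (y ` {..<k}) {..<k}"
    by (rule bij_betw_cong[THEN iffD1, rotated]) (simp add: rk_def)
  have 2: "bij_betw rk ({..<n} - y ` {..<k}) {k..<n}"
    using h by (rule bij_betw_cong[THEN iffD1, rotated]) (simp add: rk_def)
  have "bij_betw rk (y ` {..<k} \<union> ({..<n} - y ` {..<k})) ({..<k} \<union> {k..<n})"
    by (rule bij_betw_combine[OF 1 2]) auto
  moreover have "y ` {..<k} \<union> ({..<n} - y ` {..<k}) = {..<n}" "{..<k} \<union> {k..<n} = {..<n}"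
    using assms(2) \<open>k \<le> n\<close> by auto
  ultimately have "bij_betw rk {..<n} {..<n}" by simp
  moreover have "rk (y j) = j" if "j < k" for j
    using that assms(1) by (simp add: rk_def)
  ultimately show thesis by (rule that)
qed

text \<open>The generators chosen by weak concatenability are ranked below all the others, in reverse
  order: the minima of a relator avoid the generators chosen after it.\<close>

lemma weakly_concatenable_ranking:
  assumes conc: "weakly_concatenable c rs" and pres: "presentation n rs"
    and weight: "\<And>r. r \<in> set rs \<Longrightarrow> weight c r = 0"
  obtains \<xi> rk where "inj_on \<xi> {..<length rs}" "bij_betw rk {..<n} {..<n}"
    and "\<And>j e. j < length rs \<Longrightarrow> e \<in> lowest_edges c (rs ! j) \<Longrightarrow> fst e \<noteq> \<xi> j \<Longrightarrow> rk (\<xi> j) < rk (fst e)"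
    and "\<And>j. j < length rs \<Longrightarrow> \<xi> j < n"
    and "\<And>j. j < length rs \<Longrightarrow>
      weight (\<lambda>e. of_bool (e = (\<xi> j, min_weight c (rs ! j) - min 0 (c (\<xi> j))))) (lift_word c 0 (rs ! j)) \<noteq> 0"
proof -
  define k where "k = length rs"
  define M where "M j = minima (\<lambda>a. \<bar>c a\<bar>) (reorient c (rs ! j))" for j
  have "\<exists>\<sigma>. \<sigma> permutes {..<k} \<and> (\<forall>j<k. \<exists>x. x \<in> fst ` set_mset (M (\<sigma> j)) \<and>
      x \<notin> (\<Union>s<j. fst ` set_mset (M (\<sigma> s))) \<and> count (M (\<sigma> j)) (x, True) \<noteq> count (M (\<sigma> j)) (x, False))"
    using conc unfolding weakly_concatenable_def Let_def k_def M_def .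
  then obtain \<sigma> where \<sigma>: "\<sigma> permutes {..<k}"
    and "\<forall>j\<in>{..<k}. \<exists>x. x \<in> fst ` set_mset (M (\<sigma> j)) \<and>
      x \<notin> (\<Union>s<j. fst ` set_mset (M (\<sigma> s))) \<and> count (M (\<sigma> j)) (x, True) \<noteq> count (M (\<sigma> j)) (x, False)"
    by blast
  from bchoice[OF this(2)] obtain x where
    x: "\<And>j. j < k \<Longrightarrow> x j \<in> fst ` set_mset (M (\<sigma> j))"
      "\<And>j s. j < k \<Longrightarrow> s < j \<Longrightarrow> x j \<notin> fst ` set_mset (M (\<sigma> s))"
      "\<And>j. j < k \<Longrightarrow> count (M (\<sigma> j)) (x j, True) \<noteq> count (M (\<sigma> j)) (x j, False)"
    by blast
  have \<sigma>_lt: "\<sigma> j < k" if "j < k" for j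
    using permutes_in_image[OF \<sigma>, of j] that by simp
  have weight': "weight c (rs ! j) = 0" if "j < k" for j
    using weight that by (simp add: k_def)
  have M: "fst ` set_mset (M j) = fst ` lowest_edges c (rs ! j)" if "j < k" for j
    unfolding M_def using weight'[OF that] by (rule fst_minima_reorient)
  have M_sub: "fst ` set_mset (M j) \<subseteq> {..<n}" if "j < k" for j
  proof -
    have "fst ` lowest_edges c (rs ! j) \<subseteq> fst ` fst ` set (lift_word c 0 (rs ! j))"
      by (auto simp: lowest_edges_def)
    also have "\<dots> \<subseteq> {..<n}"
      using pres that unfolding fst_fst_set_lift_word
      by (auto simp: presentation_def words_def k_def dest!: nth_mem)
    finally show ?thesis using M[OF that] by simp
  qed
  have x_lt: "x j < n" if "j < k" for j
    using x(1)[OF that] M_sub[OF \<sigma>_lt[OF that]] by auto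
  have inj_x: "inj_on x {..<k}"
  proof (rule linorder_inj_onI)
    fix s j assume "s < j" "s \<in> {..<k}" "j \<in> {..<k}"
    then have "x s \<in> fst ` set_mset (M (\<sigma> s))" "x j \<notin> fst ` set_mset (M (\<sigma> s))"
      using x(1)[of s] x(2)[of j s] by simp_all
    then show "x s \<noteq> x j" by metis
  qed auto
  \<comment> \<open>The order of choice is reversed: the generator chosen last receives rank
    0.\<close>
  define y where "y i = x (k - Suc i)" for i
  have "inj_on y {..<k}"
  proof (rule inj_onI)
    fix i j assume "i \<in> {..<k}" "j \<in> {..<k}" "y i = y j"
    then show "i = j"
      using inj_onD[OF inj_x, of "k - Suc i" "k - Suc j"] by (auto simp: y_def)
  qed
  moreover have "y ` {..<k} \<subseteq> {..<n}"
    using x_lt by (auto simp: y_def)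
  ultimately obtain rk where rk: "bij_betw rk {..<n} {..<n}" "\<And>j. j < k \<Longrightarrow> rk (y j) = j"
    by (rule bij_betw_extend_inj) blast
  have rk_x: "rk (x j) = k - Suc j" if "j < k" for j
    using rk(2)[of "k - Suc j"] that by (simp add: y_def)
  \<comment> \<open>\<open>x\<close> is indexed by positions in the ordering, and
    \<open>\<tau>\<close> sends a relator to its position.\<close>
  define \<tau> where "\<tau> = inv_into UNIV \<sigma>"
  have \<tau>: "\<tau> permutes {..<k}" "\<And>j. \<sigma> (\<tau> j) = j"
    using permutes_inv[OF \<sigma>] permutes_inverses[OF \<sigma>] by (simp_all add: \<tau>_def)
  define \<xi> where "\<xi> = x \<circ> \<tau>"
  have inv: "\<tau> j < k" "\<sigma> (\<tau> j) = j" if "j < k" for j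
    using permutes_in_image[OF \<tau>(1), of j] \<tau>(2) that by auto
  show thesis
  proof (rule that)
    show "inj_on \<xi> {..<length rs}"
      unfolding \<xi>_def k_def[symmetric]
      by (rule comp_inj_on) (simp_all add: permutes_image[OF \<tau>(1)] permutes_inj_on[OF \<tau>(1)] inj_x)
    show "bij_betw rk {..<n} {..<n}" by fact
    show "\<xi> j < n" if "j < length rs" for j
      using x(1)[OF inv(1)] M_sub[of j] inv(2) that by (auto simp: \<xi>_def k_def)
    show "weight (\<lambda>e. of_bool (e = (\<xi> j, min_weight c (rs ! j) - min 0 (c (\<xi> j)))))
        (lift_word c 0 (rs ! j)) \<noteq> 0" if "j < length rs" for j
    proof -
      have "j < k" using that by (simp add: k_def)
      then show ?thesis
        using x(3)[OF inv(1)[of j]] inv(2)[of j]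
        by (intro count_minima_reorient weight') (simp_all add: \<xi>_def M_def)
    qed
    show "rk (\<xi> j) < rk (fst e)"
      if j: "j < length rs" and e: "e \<in> lowest_edges c (rs ! j)" "fst e \<noteq> \<xi> j" for j e
    proof -
      have jk: "j < k" using j by (simp add: k_def)
      let ?i = "\<tau> j"
      have a: "fst e \<in> fst ` set_mset (M (\<sigma> ?i))"
        using e(1) M[OF jk] inv(2)[OF jk] by auto
      have \<xi>: "rk (\<xi> j) = k - Suc ?i" "k - Suc ?i < k"
        using rk_x[OF inv(1)[OF jk]] jk by (auto simp: \<xi>_def)
      show ?thesis
      proof (cases "\<exists>s<k. fst e = x s")
        case True
        then obtain s where s: "s < k" "fst e = x s" by blast
        \<comment> \<open>A generator chosen later does not occur in this multiset, and one chosen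
          earlier has a larger rank.\<close>
        have "s < ?i"
        proof (rule linorder_cases[of s ?i])
          assume "?i < s"
          then have "fst e \<notin> fst ` set_mset (M (\<sigma> ?i))" using x(2)[OF s(1)] s(2) by simp
          then show ?thesis using a by contradiction
        qed (use s e(2) in \<open>auto simp: \<xi>_def\<close>)
        then show ?thesis
          using \<xi> rk_x[OF s(1)] s inv(1)[OF jk] by simp
      next
        case False
        \<comment> \<open>The chosen generators use up all ranks below \<open>k\<close>.\<close>
        have "rk (fst e) \<ge> k"
        proof (rule ccontr)
          assume "\<not> k \<le> rk (fst e)"
          then have lt: "rk (fst e) < k" by simp
          have "k - Suc (rk (fst e)) < k" using lt by simp
          then have "x (k - Suc (rk (fst e))) \<in> {..<n}"
            using x_lt by simp
          moreover have "fst e \<in> {..<n}"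
            using a M_sub inv(2)[OF jk] jk by auto
          moreover have "rk (x (k - Suc (rk (fst e)))) = rk (fst e)"
            using rk_x[of "k - Suc (rk (fst e))"] lt by simp
          ultimately have "x (k - Suc (rk (fst e))) = fst e"
            using rk(1) unfolding bij_betw_def by (metis inj_onD)
          then show False
            using False \<open>k - Suc (rk (fst e)) < k\<close> by auto
        qed
        then show ?thesis using \<xi> by simp
      qed
    qed
  qed
qed

text \<open>Division with remainder by \<open>n\<close>: the rank is the remainder, and the quotient
  determines \<open>i\<close> once \<open>a\<close> is known.\<close>

lemma bij_betw_level_rank:
  fixes n :: nat and l :: "nat \<Rightarrow> int"
  assumes rk: "bij_betw rk {..<n} {..<n}" and n: "n > 0"
  shows "bij_betw (\<lambda>(a, i). int n * (i + l a) + int (rk a)) ({..<n} \<times> UNIV) UNIV"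
proof (rule bij_betw_imageI)
  have lt: "rk a < n" if "a < n" for a
    using rk that by (auto simp: bij_betw_def)
  show "inj_on (\<lambda>(a, i). int n * (i + l a) + int (rk a)) ({..<n} \<times> UNIV)"
  proof (rule inj_onI, clarsimp)
    fix a i a' i'
    assume a: "a < n" "a' < n" and eq: "int n * (i + l a) + int (rk a) = int n * (i' + l a') + int (rk a')"
    have "int (rk a) = int (rk a')"
      using arg_cong[OF eq, of "\<lambda>z. z mod int n"] lt a by simp
    then have "a = a'"
      using rk a by (auto simp: bij_betw_def dest: inj_onD)
    then show "a = a' \<and> i = i'"
      using eq n by simp
  qed
  show "(\<lambda>(a, i). int n * (i + l a) + int (rk a)) ` ({..<n} \<times> UNIV) = UNIV"
  proof (intro equalityI subsetI UNIV_I)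
    fix z :: int
    have "nat (z mod int n) \<in> rk ` {..<n}"
      using rk n by (auto simp: bij_betw_def nat_less_iff)
    then obtain a where a: "a < n" "rk a = nat (z mod int n)" by auto
    then have "z = int n * ((z div int n - l a) + l a) + int (rk a)"
      using n by simp
    then show "z \<in> (\<lambda>(a, i). int n * (i + l a) + int (rk a)) ` ({..<n} \<times> UNIV)"
      using a(1) by (intro image_eqI[of _ _ "(a, z div int n - l a)"]) auto
  qed
qed

lemma (in presented) weight_eq_hom:
  assumes \<phi>: "\<phi> \<in> hom G integer_group" and w: "w \<in> words n"
  shows "weight (\<lambda>a. \<phi> (ev [(a, True)])) w = \<phi> (ev w)"
  using w
proof (induction w)
  case Nil
  have "group_hom G integer_group \<phi>"
    using \<phi> by (intro group_hom.intro) (auto simp: group_hom_axioms_def)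
  then show ?case
    using group_hom.hom_one[of G integer_group \<phi>] by (simp add: ev_Nil)
next
  case (Cons x w)
  interpret \<phi>: group_hom G integer_group \<phi>
    using \<phi> by (intro group_hom.intro) (auto simp: group_hom_axioms_def)
  obtain a s where x: "x = (a, s)" by force
  have a: "[(a, True)] \<in> words n" "[x] \<in> words n" "w \<in> words n" using Cons.prems x by auto
  have "ev [(a, False)] = inv (ev [(a, True)])"
    using ev_inv[OF a(1)] by (simp add: inv_letter_def)
  then have "\<phi> (ev [x]) = (if s then \<phi> (ev [(a, True)]) else - \<phi> (ev [(a, True)]))"
    using a by (auto simp: x)
  moreover have "\<phi> (ev (x # w)) = \<phi> (ev [x]) + \<phi> (ev w)"
    using ev_append[OF a(2,3)] a by simp
  ultimately show ?case
    using Cons.IH a by (simp add: x)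
qed

lemma (in group) group_H1: "group (H1 G)"
  unfolding H1_def by (rule normal.factorgroup_is_group[OF derived_self_is_normal])

theorem proposition3p3:
  fixes n :: nat
    and rs :: "nat word list"
    and G :: "('g, 'm) monoid_scheme"
    and \<theta> :: "nat word set \<Rightarrow> 'g"
    and \<phi> :: "'g \<Rightarrow> int"
  assumes "presentation n rs"
    and "group G"
    and "\<theta> \<in> iso (presented_group n rs) G"
    and "\<forall>r\<in>set rs. cyclically_reduced r"
    and "H1 G \<cong> free_Abelian_group {..<n - length rs}"
    and "\<not> trivial_group (H1 G)"
    and "\<phi> \<in> epi G integer_group"
    and "weakly_concatenable (\<lambda>a. \<phi> (\<theta> (word_class n rs [(a, True)]))) rs"
  shows "weakly_slim integer_group (standard_complex n rs)"
proof -
  interpret presented n rs G \<theta>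
    by (rule presented.intro[OF assms(1-3)])
  define c where "c a = \<phi> (ev [(a, True)])" for a
  have \<phi>: "\<phi> \<in> hom G integer_group" "\<phi> ` carrier G = UNIV"
    using assms(7) by (auto simp: epi_def)
  have weight_c: "weight c w = \<phi> (ev w)" if "w \<in> words n" for w
    unfolding c_def using weight_eq_hom[OF \<phi>(1) that] .
  have "weight c [] = \<phi> (ev [])"
    by (rule weight_c) simp
  then have weight_relator: "weight c r = 0" if "r \<in> set rs" for r
    using weight_c[of r] that assms(1) by (auto simp: presentation_def ev_relator ev_Nil)
  have weight_surj: "\<exists>w\<in>words n. weight c w = d" for d
  proof -
    have "d \<in> \<phi> ` carrier G" using \<phi>(2) by simp
    then obtain x where x: "x \<in> carrier G" "d = \<phi> x" by (rule imageE)
    obtain w where "w \<in> words n" "ev w = x"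
      using ev_surj[OF x(1)] by blast
    then show ?thesis using weight_c x(2) by auto
  qed
  \<comment> \<open>The subtraction in the rank is truncated. Otherwise the group would be free
    abelian on the empty set, contrary to nontriviality.\<close>
  have n: "length rs < n"
  proof (rule ccontr)
    assume "\<not> length rs < n"
    then have "trivial_group (free_Abelian_group {..<n - length rs})"
      by (auto simp: trivial_group_def)
    then show False
      using assms(5,6) isomorphic_group_triviality[OF assms(5)] group_H1 by simp
  qed
  have "weakly_concatenable c rs"
    using assms(8) by (simp add: c_def[abs_def] ev_def)
  then obtain \<xi> rk where \<xi>: "inj_on \<xi> {..<length rs}" and rk: "bij_betw rk {..<n} {..<n}"
    and rank: "\<And>j e. j < length rs \<Longrightarrow> e \<in> lowest_edges c (rs ! j) \<Longrightarrow> fst e \<noteq> \<xi> j \<Longrightarrow> rk (\<xi> j) < rk (fst e)"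
    and \<xi>_lt: "\<And>j. j < length rs \<Longrightarrow> \<xi> j < n"
    and exponent: "\<And>j. j < length rs \<Longrightarrow>
      weight (\<lambda>e. of_bool (e = (\<xi> j, min_weight c (rs ! j) - min 0 (c (\<xi> j))))) (lift_word c 0 (rs ! j)) \<noteq> 0"
    using weakly_concatenable_ranking[OF _ assms(1) weight_relator] by blast
  \<comment> \<open>The starting height of the lift of \<open>\<xi> j\<close> whose lower end point
    lies at the minimal weight.\<close>
  define b where "b j = min_weight c (rs ! j) - min 0 (c (\<xi> j))" for j
  \<comment> \<open>The lexicographic order by level and then rank, encoded in one integer.\<close>
  define key where "key = (\<lambda>(a, i). int n * (i + min 0 (c a)) + int (rk a))"
  have key: "key e = int n * level c e + int (rk (fst e))" for e
    by (cases e) (simp add: key_def level_def)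
  have rk_lt: "rk a < n" if "a < n" for a
    using rk that by (auto simp: bij_betw_def)
  interpret ordered_cover n rs c key \<xi> b
  proof
    show "p dvd U j" if "prime p" "\<And>g. p dvd (\<Sum>j<length rs. U j * weight g (rs ! j))" "j < length rs"
      for p :: int and U j
      using relators_independent_mod_prime[OF assms(5) _ that] n by simp
    show "bij_betw key ({..<n} \<times> UNIV) UNIV"
      unfolding key_def using bij_betw_level_rank[OF rk, of "\<lambda>a. min 0 (c a)"] n by simp
    show "key (shift t e) = key e + int n * t" for t e
      by (simp add: key level_def algebra_simps)
    show "key (\<xi> j, b j) < key e"
      if j: "j < length rs" and e: "e \<in> fst ` set (lift_word c 0 (rs ! j))" "e \<noteq> (\<xi> j, b j)" for j e
    proof -
      have lev: "level c (\<xi> j, b j) = min_weight c (rs ! j)"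
        by (simp add: level_def b_def)
      have w: "weight c (rs ! j) = 0" using j by (intro weight_relator) simp
      show ?thesis
      proof (cases "level c e = min_weight c (rs ! j)")
        case True
        then have low: "e \<in> lowest_edges c (rs ! j)" using e(1) by (simp add: lowest_edges_def)
        have "fst e \<noteq> \<xi> j"
          using lowest_edges_unique[of "fst e" "snd e"] low e(2) by (cases e) (auto simp: b_def)
        then show ?thesis
          using rank[OF j low] by (simp add: key lev True)
      next
        case False
        \<comment> \<open>One level more adds \<open>n\<close> to the key, which outweighs any
          difference of ranks.\<close>
        then have "level c e \<ge> min_weight c (rs ! j) + 1"
          using level_ge_min_weight[OF w e(1)] by simp
        then have "int n * level c e \<ge> int n * (min_weight c (rs ! j) + 1)"
          by (intro mult_left_mono) auto
        then show ?thesis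
          using rk_lt[OF \<xi>_lt[OF j]] by (simp add: key lev algebra_simps)
      qed
    qed
  qed (use assms(1) weight_relator weight_surj \<xi> exponent in \<open>auto simp: b_def\<close>)
  show ?thesis by (rule weakly_slim_standard_complex)
qed

end
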